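(* Let $z\in\mathbb{C}\setminus(-\infty,1]$ and $\nu,\mu\in\mathbb{C}^\ast$ such that $\Re\mu>0$ and $\Re(\nu-\mu)>-1$. Then $$Q_\nu^\mu(z)=\frac{\Gamma(\nu+\mu+1)}{\Gamma(2\mu)\Gamma(\nu-\mu+1)(z^2-1)^{\frac12\mu}}\int_z^\infty Q_\nu^{\mu}(w)\,\frac{(w-z)^{2\mu-1}}{(w^2-1)^{\frac12\mu}}\,dw .$$
   Context: $\mathbb{C}^\ast=\mathbb{C}\setminus\{0\}$. The associated Legendre function of the second kind on $\mathbb{C}\setminus(-\infty,1]$ is $Q_\nu^\mu(z)=\frac{\sqrt\pi\,e^{i\pi\mu}\Gamma(\nu+\mu+1)(z^2-1)^{\mu/2}}{2^{\nu+1}z^{\nu+\mu+1}}\mathbf{F}\big(\frac{\nu+\mu+1}{2},\frac{\nu+\mu+2}{2};\nu+\frac32;\frac1{z^2}\big)$ for $|z|>1$, continued analytically, where $\mathbf{F}(a,b;c;z)=\sum_{n\ge0}\frac{(a)_n(b)_n}{\Gamma(c+n)}\frac{z^n}{n!}$ is the regularized Gauss hypergeometric function. Convention: the basic range is $z>1$ real (integration along the real axis, powers of positive numbers positive for real exponents); for complex $z$ both sides are understood by analytic continuation (equivalently, integration along a path from $z$ to $+\infty$ in the cut plane, e.g. $w=z+t$, $t>0$, for nonreal $z$). *)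

theory Defs
  imports "HOL-Complex_Analysis.Complex_Analysis"
begin

text \<open>The regularized Gauss hypergeometric series; meaningful for \<open>norm z < 1\<close>. The reciprocal Gamma
  function is entire, so no condition on \<open>c\<close> is needed.\<close>

definition hypergeo_reg_2F1 :: "complex \<Rightarrow> complex \<Rightarrow> complex \<Rightarrow> complex \<Rightarrow> complex" where
  "hypergeo_reg_2F1 a b c z =
     (\<Sum>n. pochhammer a n * pochhammer b n * rGamma (c + of_nat n) * z ^ n / fact n)"

definition legendre_domain :: "complex set" where
  "legendre_domain = - (complex_of_real ` {..1})"

text \<open>The branch of \<open>(z\<^sup>2 - 1)\<^sup>a\<close> that is holomorphic on \<^const>\<open>legendre_domain\<close> and positive for real \<open>a\<close>
  and real \<open>z > 1\<close>. It is the continuation of \<open>(z\<^sup>2 - 1) powr a\<close> from the right half-plane; the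
  latter expression itself jumps across the imaginary axis.\<close>

definition sq_minus_one_powr :: "complex \<Rightarrow> complex \<Rightarrow> complex" where
  "sq_minus_one_powr z a = (z - 1) powr a * (z + 1) powr a"

definition legendre_Q_series :: "complex \<Rightarrow> complex \<Rightarrow> complex \<Rightarrow> complex" where
  "legendre_Q_series \<nu> \<mu> z =
     of_real (sqrt pi) * exp (\<i> * of_real pi * \<mu>) * Gamma (\<nu> + \<mu> + 1) * sq_minus_one_powr z (\<mu> / 2)
       / (2 powr (\<nu> + 1) * z powr (\<nu> + \<mu> + 1))
     * hypergeo_reg_2F1 ((\<nu> + \<mu> + 1) / 2) ((\<nu> + \<mu> + 2) / 2) (\<nu> + 3 / 2) (1 / z\<^sup>2)"

text \<open>Analytic continuation of the series from \<open>norm z > 1\<close> to the whole (simply connected) cut plane.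
  The continuation is unique on \<^const>\<open>legendre_domain\<close>, and values off that set are irrelevant.\<close>

definition legendre_Q :: "complex \<Rightarrow> complex \<Rightarrow> complex \<Rightarrow> complex" where
  "legendre_Q \<nu> \<mu> =
     (SOME f. f holomorphic_on legendre_domain \<and>
        (\<forall>z\<in>legendre_domain. norm z > 1 \<longrightarrow> f z = legendre_Q_series \<nu> \<mu> z))"

text \<open>The integral of \<open>f\<close> from \<open>z\<close> to \<open>+\<infinity>\<close> along the horizontal ray \<open>w = z + t\<close>, \<open>t > 0\<close>, which stays in
  \<^const>\<open>legendre_domain\<close> whenever \<open>z\<close> is in it; for real \<open>z > 1\<close> this is the integral along the real axis.\<close>

definition ray_integrable :: "complex \<Rightarrow> (complex \<Rightarrow> complex) \<Rightarrow> bool" where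
  "ray_integrable z f \<longleftrightarrow> set_integrable lborel {0<..} (\<lambda>t::real. f (z + of_real t))"

definition ray_integral :: "complex \<Rightarrow> (complex \<Rightarrow> complex) \<Rightarrow> complex" where
  "ray_integral z f = (LBINT t:{0<..}. f (z + of_real t))"

end

theory Submission
  imports Defs
begin

text \<open>Put \<open>E s z = \<integral>\<^sub>-\<^sub>1\<^sup>1 (1 - t\<^sup>2) powr \<nu> * (z - t) powr (- s) dt\<close>, which is holomorphic on the cut plane.
  Expanding \<open>(1 - t/z) powr (- s)\<close> binomially shows that \<open>Q\<close> is a constant times
  \<open>(z\<^sup>2 - 1) powr (\<mu>/2) * E (\<nu> + \<mu> + 1) z\<close>; in particular the analytic continuation exists. For real \<open>z > 1\<close>,
  integrating \<open>E (\<nu> + \<mu> + 1) (z + u)\<close> against \<open>u powr (2\<mu> - 1)\<close> gives a beta function times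
  \<open>E (\<nu> - \<mu> + 1) z\<close> by Fubini, and the substitution \<open>t \<mapsto> (1 - z t) / (z - t)\<close> turns this into
  \<open>(z\<^sup>2 - 1) powr \<mu> * E (\<nu> + \<mu> + 1) z\<close>. The identity theorem extends the formula to the cut plane.\<close>

subsection \<open>Complex powers, substitution and parameter integrals\<close>

text \<open>Put a = 2\<mu> and s = \<nu> + \<mu> + 1, so that s - a = \<nu> - \<mu> + 1. The
  hypotheses on the real parts say exactly 0 < Re a < Re s, the range of convergence of the beta
  integral; together they give Re \<nu> > -1, which makes the weight of \<open>E\<close> integrable
  at both endpoints. The integration against the power of u replaces \<mu> by -\<mu> in the exponent
  of \<open>E\<close>, and the substitution undoes this: it is the fact that Q with -\<mu> is a
  constant multiple of Q with \<mu>, in the form that this takes for \<open>E\<close>. Both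
  computations rest on powers of positive reals, for which logarithms add; principal powers of
  complex numbers do not split freely. They are therefore made for z > 1 only, and the remaining
  work lies in bounds that are locally uniform in z, by which both sides become holomorphic.\<close>

lemma of_real_powr_eq_exp:
  fixes x :: real and z :: complex
  assumes "x > 0"
  shows "of_real x powr z = exp (z * of_real (ln x))"
  using assms by (simp add: powr_def Ln_of_real)

lemma of_real_powr_mult:
  fixes a b :: real and z :: complex
  assumes "a > 0" "b > 0"
  shows "of_real (a * b) powr z = of_real a powr z * of_real b powr z"
  using powr_times_real[of "of_real a" "of_real b" z] assms by simp

lemma of_real_powr_divide:
  fixes a b :: real and z :: complex
  assumes "a > 0" "b > 0"
  shows "of_real (a / b) powr z = of_real a powr z * of_real b powr (- z)"
  using assms by (simp add: powr_def Ln_of_real ln_div ring_distribs flip: exp_add of_real_divide)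

text \<open>For Borel measurable functions, completing \<open>lborel\<close> changes neither
  integrability nor the integral. This carries the change of variables for absolutely integrable
  functions over to set integrals.\<close>

lemma set_lborel_change_of_variables:
  fixes f :: "real \<Rightarrow> complex" and g h :: "real \<Rightarrow> real"
  assumes S: "S \<in> sets borel" and gS: "g ` S \<in> sets borel"
    and der: "\<And>x. x \<in> S \<Longrightarrow> (g has_field_derivative h x) (at x)"
    and inj: "inj_on g S"
    and f [measurable]: "f \<in> borel_measurable borel" and h [measurable]: "h \<in> borel_measurable borel"
    and g [measurable]: "g \<in> borel_measurable borel"
    and int: "set_integrable lborel (g ` S) f"
  shows "set_integrable lborel S (\<lambda>x. \<bar>h x\<bar> *\<^sub>R f (g x))"
    and "(LBINT x:S. \<bar>h x\<bar> *\<^sub>R f (g x)) = (LBINT x:g ` S. f x)"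
proof -
  note [measurable] = S gS
  have "f absolutely_integrable_on g ` S" "integral (g ` S) f = (LBINT x:g ` S. f x)"
    using int set_borel_integral_eq_integral(2)[OF int]
    by (auto simp: set_integrable_def integrable_completion)
  then have *: "(\<lambda>x. \<bar>h x\<bar> *\<^sub>R f (g x)) absolutely_integrable_on S"
      "integral S (\<lambda>x. \<bar>h x\<bar> *\<^sub>R f (g x)) = (LBINT x:g ` S. f x)"
    using has_absolute_integral_change_of_variables_real[of S g h f "LBINT x:g ` S. f x"] S
      has_field_derivative_at_within[OF der] inj by auto
  from *(1) show int': "set_integrable lborel S (\<lambda>x. \<bar>h x\<bar> *\<^sub>R f (g x))"
    by (simp add: set_integrable_def integrable_completion)
  show "(LBINT x:S. \<bar>h x\<bar> *\<^sub>R f (g x)) = (LBINT x:g ` S. f x)"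
    using *(2) set_borel_integral_eq_integral(2)[OF int'] by simp
qed

text \<open>Only \<open>f\<close> itself has to be dominated, locally uniformly in z. Cauchy's
  inequality turns this into a bound on the derivative in z, hence on the difference quotients, and
  dominated convergence gives the derivative of the integral.\<close>

lemma holomorphic_on_integral:
  fixes f :: "complex \<Rightarrow> 'a \<Rightarrow> complex"
  assumes S: "open S"
    and holo: "\<And>x. x \<in> space M \<Longrightarrow> (\<lambda>z. f z x) holomorphic_on S"
    and meas: "\<And>z. z \<in> S \<Longrightarrow> f z \<in> borel_measurable M"
    and dom: "\<And>z. z \<in> S \<Longrightarrow> \<exists>r>0. cball z r \<subseteq> S \<and>
                (\<exists>g. integrable M g \<and> (\<forall>w\<in>cball z r. \<forall>x\<in>space M. norm (f w x) \<le> g x))"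
  shows "(\<lambda>z. \<integral>x. f z x \<partial>M) holomorphic_on S"
  unfolding holomorphic_on_open[OF S]
proof
  fix z assume z: "z \<in> S"
  from dom[OF this] obtain r g where r: "r > 0" "cball z r \<subseteq> S" and g: "integrable M g"
    and le: "\<And>w x. w \<in> cball z r \<Longrightarrow> x \<in> space M \<Longrightarrow> norm (f w x) \<le> g x" by metis
  have int: "integrable M (f w)" if "w \<in> cball z r" for w
    using that r(2) le by (intro Bochner_Integration.integrable_bound[OF g meas]) (force intro!: AE_I2)+
  \<comment> \<open>The radius is halved so that the disc of radius r/2 about any point y of the
    smaller disc stays inside \<open>cball z r\<close>, where \<open>g\<close> dominates. This is
    the source of the factor 2 / r.\<close>
  have dq: "norm ((f w x - f z x) / (w - z)) \<le> 2 * g x / r"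
    if w: "w \<in> cball z (r/2)" "w \<noteq> z" and x: "x \<in> space M" for w x
  proof -
    have "norm (f w x - f z x) \<le> (g x / (r/2)) * norm (w - z)"
    proof (rule field_differentiable_bound[of "cball z (r/2)"])
      fix y assume y: "y \<in> cball z (r/2)"
      have sub: "cball y (r/2) \<subseteq> cball z r" using y by (auto simp: cball_subset_cball_iff dist_commute)
      with r(2) have sub': "cball y (r/2) \<subseteq> S" by blast
      have h: "(\<lambda>z. f z x) holomorphic_on cball y (r/2)"
        using holo[OF x] sub' by (rule holomorphic_on_subset)
      have "y \<in> S" using sub' r(1) by auto
      then have "(\<lambda>z. f z x) field_differentiable at y"
        using holo[OF x] S by (simp add: holomorphic_on_imp_differentiable_at)
      then show "((\<lambda>z. f z x) has_field_derivative deriv (\<lambda>z. f z x) y) (at y within cball z (r/2))"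
        by (simp add: field_differentiable_derivI has_field_derivative_at_within)
      show "norm (deriv (\<lambda>z. f z x) y) \<le> g x / (r/2)"
      proof -
        have "norm ((deriv ^^ 1) (\<lambda>z. f z x) y) \<le> fact 1 * g x / (r/2) ^ 1"
        proof (rule Cauchy_inequality)
          show "(\<lambda>z. f z x) holomorphic_on ball y (r/2)"
            using h by (rule holomorphic_on_subset) auto
          show "norm (f w x) \<le> g x" if "norm (y - w) = r/2" for w
            using sub that by (intro le x) (auto simp: dist_norm)
        qed (use h r(1) in \<open>auto intro: holomorphic_on_imp_continuous_on\<close>)
        then show ?thesis by simp
      qed
    qed (use w r in auto)
    then show ?thesis using w r(1) by (simp add: norm_divide field_simps)
  qed
  define D where "D x = deriv (\<lambda>z. f z x) z" for x
  have lim: "((\<lambda>w. (f w x - f z x) / (w - z)) \<longlongrightarrow> D x) (at z)" if "x \<in> space M" for x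
    using holomorphic_derivI[OF holo[OF that] S z] unfolding D_def has_field_derivative_iff .
  \<comment> \<open>Dominated convergence is sequential, so the limit at z is taken along arbitrary
    sequences in the smaller disc.\<close>
  have main: "(\<lambda>n. \<integral>x. (f (X n) x - f z x) / (X n - z) \<partial>M) \<longlonglongrightarrow> (\<integral>x. D x \<partial>M)"
    if X: "\<And>n. X n \<in> cball z (r/2)" "\<And>n. X n \<noteq> z" "X \<longlonglongrightarrow> z" for X
  proof (rule integral_dominated_convergence)
    have mX [measurable]: "f (X n) \<in> borel_measurable M" for n
      by (rule meas) (use r X(1)[of n] in auto)
    have mz [measurable]: "f z \<in> borel_measurable M" by (rule meas[OF z])
    show m: "(\<lambda>x. (f (X n) x - f z x) / (X n - z)) \<in> borel_measurable M" for n
      by measurable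
    have lims: "(\<lambda>n. (f (X n) x - f z x) / (X n - z)) \<longlonglongrightarrow> D x" if "x \<in> space M" for x
      using lim[OF that] X unfolding tendsto_at_iff_sequentially comp_def by auto
    then show "AE x in M. (\<lambda>n. (f (X n) x - f z x) / (X n - z)) \<longlonglongrightarrow> D x" by auto
    show "D \<in> borel_measurable M"
      using lims m by (rule borel_measurable_LIMSEQ_metric[rotated])
    show "integrable M (\<lambda>x. 2 * g x / r)" using g by simp
    show "AE x in M. norm ((f (X n) x - f z x) / (X n - z)) \<le> 2 * g x / r" for n
      using dq X by auto
  qed
  have "((\<lambda>w. (\<integral>x. f w x \<partial>M)) has_field_derivative (\<integral>x. D x \<partial>M)) (at z within cball z (r/2))"
    unfolding has_field_derivative_iff tendsto_at_iff_sequentially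
  proof (intro allI impI)
    fix X assume X: "\<forall>i. X i \<in> cball z (r/2) - {z}" "X \<longlonglongrightarrow> z"
    have "X n \<in> cball z r" "z \<in> cball z r" for n using X(1) r(1) by auto (smt (verit) mem_cball DiffE)
    then have "(\<integral>x. (f (X n) x - f z x) / (X n - z) \<partial>M) = ((\<integral>x. f (X n) x \<partial>M) - (\<integral>x. f z x \<partial>M)) / (X n - z)" for n
      using int by simp
    with main[of X] X show "((\<lambda>y. ((\<integral>x. f y x \<partial>M) - (\<integral>x. f z x \<partial>M)) / (y - z)) \<circ> X) \<longlonglongrightarrow> (\<integral>x. D x \<partial>M)"
      by (simp add: comp_def)
  qed
  then have "((\<lambda>w. (\<integral>x. f w x \<partial>M)) has_field_derivative (\<integral>x. D x \<partial>M)) (at z)"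
    using r(1) by (metis at_within_interior centre_in_ball half_gt_zero interior_cball)
  then show "\<exists>f'. ((\<lambda>z. \<integral>x. f z x \<partial>M) has_field_derivative f') (at z)" ..
qed

subsection \<open>The beta integral on the half line\<close>

lemma Gamma_nonzero_if_Re_pos:
  fixes s :: complex
  assumes "Re s > 0"
  shows "Gamma s \<noteq> 0"
proof
  assume "Gamma s = 0"
  then obtain k where "s = of_int k" "k \<le> 0" by (auto simp: Gamma_eq_zero_iff elim!: nonpos_Ints_cases)
  with assms show False by simp
qed

text \<open>The Mellin kernel. With the indicator built in, integrals over the half line are
  integrals over all of \<open>lborel\<close>, the form that Fubini's theorem takes, and values of
  the power at nonpositive t are irrelevant. The weight on (-1, 1) is encoded in the same
  way.\<close>

definition gamma_weight :: "complex \<Rightarrow> real \<Rightarrow> complex" where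
  "gamma_weight a t = indicat_real {0<..} t *\<^sub>R of_real t powr (a - 1)"

lemma gamma_weight_measurable [measurable]: "gamma_weight a \<in> borel_measurable borel"
  unfolding gamma_weight_def by measurable

text \<open>Absolute values stay within the family of weights, so the absolute integrability that
  Fubini's theorem asks for can be computed by the same Gamma integral at a real parameter.\<close>

lemma norm_gamma_weight: "complex_of_real (norm (gamma_weight a t)) = gamma_weight (of_real (Re a)) t"
  using powr_of_real[of t "Re a - 1"]
  by (cases "t > 0") (simp_all add: gamma_weight_def norm_powr_real_powr)

text \<open>Euler's integral for Gamma after the scaling t = r u: the weight is homogeneous of
  degree a - 1, and the Jacobian contributes one more power of r.\<close>

lemma has_bochner_integral_gamma_weight_exp:
  assumes "Re a > 0" and r: "r > 0"
  shows "has_bochner_integral lborel (\<lambda>u. gamma_weight a u * of_real (exp (- (r * u))))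
           (Gamma a * of_real r powr (- a))"
proof -
  have ab: "(\<lambda>t. complex_of_real t powr (a - 1) / of_real (exp t)) absolutely_integrable_on {0<..}"
    by (rule absolutely_integrable_Gamma_integral') fact
  have eq: "indicat_real {0<..} t *\<^sub>R (complex_of_real t powr (a - 1) / of_real (exp t))
      = gamma_weight a t * of_real (exp (- t))" for t
    by (simp add: gamma_weight_def exp_minus field_simps)
  have "integrable lborel (\<lambda>t. gamma_weight a t * of_real (exp (- t)))"
    using ab unfolding set_integrable_def eq by (simp add: integrable_completion)
  moreover have "(\<integral>t. gamma_weight a t * of_real (exp (- t)) \<partial>lborel) = Gamma a"
    using has_integral_set_lebesgue[OF ab] Gamma_integral_complex'[OF assms(1)]
    unfolding set_lebesgue_integral_def eq
    by (simp add: integral_completion has_integral_unique)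
  ultimately have "has_bochner_integral lborel (\<lambda>t. gamma_weight a t * of_real (exp (- t))) (Gamma a)"
    by (simp add: has_bochner_integral_iff)
  then have "has_bochner_integral lborel (\<lambda>u. gamma_weight a (0 + r * u) * of_real (exp (- (0 + r * u)))) (Gamma a /\<^sub>R \<bar>r\<bar>)"
    using r by (subst (asm) lborel_has_bochner_integral_real_affine_iff[of r _ _ 0]) auto
  moreover have "gamma_weight a (0 + r * u) = of_real r powr (a - 1) * gamma_weight a u" for u
    using r by (auto simp: gamma_weight_def indicator_def of_real_powr_mult zero_less_mult_iff
        simp flip: of_real_mult)
  ultimately have "has_bochner_integral lborel
      (\<lambda>u. of_real r powr (1 - a) * (of_real r powr (a - 1) * gamma_weight a u * of_real (exp (- (0 + r * u)))))
      (of_real r powr (1 - a) * (Gamma a /\<^sub>R \<bar>r\<bar>))"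
    by (intro has_bochner_integral_mult_right) simp_all
  moreover have "of_real r powr (1 - a) * (of_real r powr (a - 1)) = (1::complex)"
    using r by (simp flip: powr_add)
  then have "of_real r powr (1 - a) * (of_real r powr (a - 1) * gamma_weight a u * of_real (exp (- (0 + r * u))))
      = gamma_weight a u * of_real (exp (- (r * u)))" for u
    by (metis add_0 mult.assoc mult_1)
  then have "(\<lambda>u. of_real r powr (1 - a) * (of_real r powr (a - 1) * gamma_weight a u * of_real (exp (- (0 + r * u)))))
      = (\<lambda>u. gamma_weight a u * of_real (exp (- (r * u))))" ..
  moreover have "of_real r powr (1 - a) * (Gamma a /\<^sub>R \<bar>r\<bar>) = Gamma a * of_real r powr (- a)"
    using r by (simp add: powr_diff powr_minus scaleR_conv_of_real field_simps)
  ultimately show ?thesis by (simp only:)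
qed

text \<open>Write \<open>(x + u) powr (- s)\<close> as a Gamma integral and interchange the two integrations.\<close>

lemma has_bochner_integral_Beta_halfline:
  assumes a: "Re a > 0" and s: "Re s > Re a" and x: "x > 0"
  shows "has_bochner_integral lborel (\<lambda>u. gamma_weight a u * of_real (x + u) powr (- s))
           (Gamma a * Gamma (s - a) / Gamma s * of_real x powr (a - s))"
proof -
  \<comment> \<open>Integrated over r, \<open>F\<close> gives \<open>Gamma s\<close> times the
    integrand of the claim (\<open>F2\<close>). Integrated over u, it gives \<open>Gamma a\<close>
    and a power of r that lowers the weight parameter from s to s - a (\<open>F1\<close>); the
    integral over r is then another Gamma integral.\<close>
  define F where "F r u = gamma_weight a u * gamma_weight s r * of_real (exp (- (r * (x + u))))" for r u
  have s0: "Re s > 0" "Re (s - a) > 0" using a s by auto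
  have e: "exp (- (r * (x + u))) = exp (- (x * r)) * exp (- (r * u))" for r u
    by (simp add: algebra_simps flip: exp_add)
  have F1: "has_bochner_integral lborel (F r)
      (Gamma a * (gamma_weight (s - a) r * of_real (exp (- (x * r)))))" for r
  proof (cases "r > 0")
    case True
    have "has_bochner_integral lborel (\<lambda>u. (gamma_weight s r * of_real (exp (- (x * r)))) *
        (gamma_weight a u * of_real (exp (- (r * u)))))
        ((gamma_weight s r * of_real (exp (- (x * r)))) * (Gamma a * of_real r powr (- a)))"
      by (intro has_bochner_integral_mult_right has_bochner_integral_gamma_weight_exp a True)
    moreover have "gamma_weight s r * of_real r powr (- a) = gamma_weight (s - a) r"
      using True by (simp add: gamma_weight_def algebra_simps flip: powr_add)
    then have "(gamma_weight s r * of_real (exp (- (x * r)))) * (Gamma a * of_real r powr (- a)) =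
        Gamma a * (gamma_weight (s - a) r * of_real (exp (- (x * r))))"
      by (simp only: mult_ac flip: \<open>gamma_weight s r * of_real r powr (- a) = gamma_weight (s - a) r\<close>)
    moreover have "F r = (\<lambda>u. (gamma_weight s r * of_real (exp (- (x * r)))) *
        (gamma_weight a u * of_real (exp (- (r * u)))))"
      by (simp add: F_def fun_eq_iff e mult_ac)
    ultimately show ?thesis by simp
  next
    case False
    then show ?thesis by (simp add: F_def[abs_def] gamma_weight_def has_bochner_integral_zero)
  qed
  have F2: "has_bochner_integral lborel (\<lambda>r. F r u) (Gamma s * (gamma_weight a u * of_real (x + u) powr (- s)))" for u
  proof (cases "u > 0")
    case True
    then have "has_bochner_integral lborel
       (\<lambda>r. gamma_weight a u * (gamma_weight s r * of_real (exp (- ((x + u) * r)))))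
       (gamma_weight a u * (Gamma s * of_real (x + u) powr (- s)))"
      using x by (intro has_bochner_integral_mult_right has_bochner_integral_gamma_weight_exp s0) auto
    then show ?thesis by (simp add: F_def[abs_def] mult_ac)
  next
    case False
    then show ?thesis by (simp add: F_def[abs_def] gamma_weight_def has_bochner_integral_zero)
  qed
  \<comment> \<open>The integral of the modulus is computed exactly: it is the modulus of the value
    in \<open>F1\<close>, up to \<open>Gamma (Re a)\<close> in place of \<open>Gamma a\<close>. Its
    integrability in r is then that of \<open>outer\<close>.\<close>
  have Fn: "has_bochner_integral lborel (\<lambda>u. norm (F r u))
      (norm (Gamma (of_real (Re a)) * (gamma_weight (s - a) r * of_real (exp (- (x * r))))))" for r
  proof (cases "r > 0")
    case True
    have i: "integrable lborel (\<lambda>u. norm (F r u))"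
      using F1 by (auto simp: has_bochner_integral_iff)
    have "complex_of_real (\<integral>u. norm (F r u) \<partial>lborel) = (\<integral>u. of_real (norm (F r u)) \<partial>lborel)"
      by (rule integral_complex_of_real[symmetric])
    also have "\<dots> = (\<integral>u. of_real (norm (gamma_weight s r) * exp (- (x * r))) *
        (gamma_weight (of_real (Re a)) u * of_real (exp (- (r * u)))) \<partial>lborel)"
      by (rule Bochner_Integration.integral_cong)
        (simp_all add: F_def norm_mult e mult_ac flip: norm_gamma_weight)
    also have "\<dots> = of_real (norm (gamma_weight s r) * exp (- (x * r))) * (Gamma (of_real (Re a)) * of_real r powr (- of_real (Re a)))"
      using has_bochner_integral_integral_eq[OF has_bochner_integral_gamma_weight_exp[of "of_real (Re a)" r]] a True
      by simp
    also have "\<dots> = of_real (norm (gamma_weight s r) * exp (- (x * r)) * (Gamma (Re a) * r powr (- Re a)))"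
      using True powr_of_real[of r "- Re a"] by (simp add: Gamma_complex_of_real)
    finally have "(\<integral>u. norm (F r u) \<partial>lborel) = norm (gamma_weight s r) * exp (- (x * r)) * (Gamma (Re a) * r powr (- Re a))"
      using of_real_eq_iff by blast
    also have "\<dots> = norm (Gamma (of_real (Re a)) * (gamma_weight (s - a) r * of_real (exp (- (x * r)))))"
    proof -
      have "r powr (Re s - 1) * r powr (- Re a) = r powr (Re s - Re a - 1)"
        by (simp add: algebra_simps flip: powr_add)
      then show ?thesis
        using True a Gamma_real_pos[of "Re a"]
        by (simp add: norm_mult gamma_weight_def Gamma_complex_of_real norm_powr_real_powr)
    qed
    finally show ?thesis using i by (simp add: has_bochner_integral_iff)
  next
    case False
    then show ?thesis by (simp add: F_def[abs_def] gamma_weight_def has_bochner_integral_zero)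
  qed
  have outer: "has_bochner_integral lborel (\<lambda>r. gamma_weight (s - a) r * of_real (exp (- (x * r))))
       (Gamma (s - a) * of_real x powr (- (s - a)))"
    by (rule has_bochner_integral_gamma_weight_exp) (use s0 x in auto)
  have "integrable (lborel \<Otimes>\<^sub>M lborel) (case_prod F)"
  proof (rule lborel_pair.Fubini_integrable)
    show "case_prod F \<in> borel_measurable (lborel \<Otimes>\<^sub>M lborel)"
      unfolding F_def[abs_def] by measurable
    show "integrable lborel (\<lambda>r. \<integral>u. norm (case_prod F (r, u)) \<partial>lborel)"
      using has_bochner_integral_integral_eq[OF Fn] outer
      by (auto simp: has_bochner_integral_iff intro!: integrable_norm)
    show "AE r in lborel. integrable lborel (\<lambda>u. case_prod F (r, u))"
      using F1 by (auto simp: has_bochner_integral_iff)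
  qed
  from lborel_pair.integrable_snd[OF this] lborel_pair.Fubini_integral[OF this]
  have int: "integrable lborel (\<lambda>u. Gamma s * (gamma_weight a u * of_real (x + u) powr (- s)))"
    and eq: "(\<integral>u. Gamma s * (gamma_weight a u * of_real (x + u) powr (- s)) \<partial>lborel) =
       (\<integral>r. Gamma a * (gamma_weight (s - a) r * of_real (exp (- (x * r)))) \<partial>lborel)"
    using has_bochner_integral_integral_eq[OF F1] has_bochner_integral_integral_eq[OF F2] by auto
  have nz: "Gamma s \<noteq> 0"
    using s0 by (intro Gamma_nonzero_if_Re_pos)
  have "integrable lborel (\<lambda>u. inverse (Gamma s) * (Gamma s * (gamma_weight a u * of_real (x + u) powr (- s))))"
    using int by (rule integrable_mult_right)
  then have "integrable lborel (\<lambda>u. gamma_weight a u * of_real (x + u) powr (- s))"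
    by (simp only: mult.assoc[symmetric] left_inverse[OF nz] mult_1)
  moreover have "Gamma s * (\<integral>u. gamma_weight a u * of_real (x + u) powr (- s) \<partial>lborel) =
       Gamma a * (Gamma (s - a) * of_real x powr (a - s))"
    using eq has_bochner_integral_integral_eq[OF outer] by simp
  then have "(\<integral>u. gamma_weight a u * of_real (x + u) powr (- s) \<partial>lborel) =
      Gamma a * Gamma (s - a) / Gamma s * of_real x powr (a - s)"
    using nz by (simp add: eq_divide_eq mult.assoc mult.commute[of _ "Gamma s"] del: of_real_add)
  ultimately show ?thesis
    by (simp only: has_bochner_integral_iff simp_thms)
qed

subsection \<open>Euler integrals for the Legendre function\<close>

definition legendre_weight :: "complex \<Rightarrow> real \<Rightarrow> complex" where
  "legendre_weight \<nu> t = indicat_real {-1<..<1} t *\<^sub>R of_real (1 - t\<^sup>2) powr \<nu>"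

lemma legendre_weight_measurable [measurable]: "legendre_weight \<nu> \<in> borel_measurable borel"
  unfolding legendre_weight_def by measurable

lemma legendre_weight_minus [simp]: "legendre_weight \<nu> (- t) = legendre_weight \<nu> t"
  by (auto simp: legendre_weight_def indicator_def)

text \<open>Since 1 - x^2 = 4 * ((1 + x) / 2) * ((1 - x) / 2), the modulus of the weight is an
  affinely rescaled Beta integrand with both parameters equal to Re \<nu> + 1.\<close>

lemma integrable_legendre_weight:
  assumes "Re \<nu> > -1"
  shows "integrable lborel (legendre_weight \<nu>)"
proof -
  define B where "B x = indicat_real {0..1} x *\<^sub>R (x powr (Re \<nu> + 1 - 1) * (1 - x) powr (Re \<nu> + 1 - 1))" for x
  have "integrable lborel B"
    using integrable_Beta[of "Re \<nu> + 1" "Re \<nu> + 1"] assms by (simp add: set_integrable_def B_def[abs_def])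
  then have "integrable lborel (\<lambda>x. 4 powr Re \<nu> * B (1/2 + 1/2 * x))"
    by (intro integrable_mult_right lborel_integrable_real_affine) auto
  then show ?thesis
  proof (rule Bochner_Integration.integrable_bound)
    show "AE x in lborel. norm (legendre_weight \<nu> x) \<le> norm (4 powr Re \<nu> * B (1/2 + 1/2 * x))"
    proof (rule AE_I2)
      fix x :: real
      show "norm (legendre_weight \<nu> x) \<le> norm (4 powr Re \<nu> * B (1/2 + 1/2 * x))"
      proof (cases "x \<in> {-1<..<1}")
        case True
        have "1 - x\<^sup>2 = 4 * ((1/2 + 1/2 * x) * (1 - (1/2 + 1/2 * x)))"
          by (simp add: field_simps power2_eq_square)
        then have "(1 - x\<^sup>2) powr Re \<nu> = (4 * ((1/2 + 1/2 * x) * (1 - (1/2 + 1/2 * x)))) powr Re \<nu>"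
          by (rule arg_cong)
        also have "\<dots> = 4 powr Re \<nu> * ((1/2 + 1/2 * x) powr Re \<nu> * (1 - (1/2 + 1/2 * x)) powr Re \<nu>)"
          using True by (subst powr_mult | simp)+
        also have "\<dots> = 4 powr Re \<nu> * B (1/2 + 1/2 * x)"
          using True by (simp add: B_def)
        finally show ?thesis
          using True abs_square_less_1[of x] norm_powr_real_powr[of "of_real (1 - x\<^sup>2)" \<nu>]
          by (simp add: legendre_weight_def abs_if split: if_splits)
      qed (simp add: legendre_weight_def)
    qed
  qed auto
qed

lemma integrable_legendre_weight_mult:
  assumes "Re \<nu> > -1" and [measurable]: "f \<in> borel_measurable borel"
    and "\<And>t. t \<in> {-1<..<1} \<Longrightarrow> norm (f t :: complex) \<le> C"
  shows "integrable lborel (\<lambda>t. legendre_weight \<nu> t * f t)"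
proof (rule Bochner_Integration.integrable_bound)
  show "integrable lborel (\<lambda>t. C * norm (legendre_weight \<nu> t))"
    using integrable_legendre_weight[OF assms(1)] by (intro integrable_mult_right integrable_norm)
  have "norm (legendre_weight \<nu> t * f t) \<le> norm (C * norm (legendre_weight \<nu> t))" for t
  proof (cases "t \<in> {-1<..<1}")
    case True
    have "norm (legendre_weight \<nu> t) * norm (f t) \<le> norm (legendre_weight \<nu> t) * C"
      using assms(3)[OF True] by (rule mult_left_mono) simp
    also have "\<dots> \<le> norm (C * norm (legendre_weight \<nu> t))"
      by (simp add: abs_mult mult.commute mult_right_mono)
    finally show ?thesis by (simp add: norm_mult)
  qed (simp add: legendre_weight_def)
  then show "AE t in lborel. norm (legendre_weight \<nu> t * f t) \<le> norm (C * norm (legendre_weight \<nu> t))" by simp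
qed measurable

lemma legendre_weight_odd_moment:
  assumes "odd n"
  shows "(\<integral>t. legendre_weight \<nu> t * of_real t ^ n \<partial>lborel) = 0"
proof -
  have "(\<integral>t. legendre_weight \<nu> t * of_real t ^ n \<partial>lborel) = - (\<integral>t. legendre_weight \<nu> t * of_real t ^ n \<partial>lborel)"
    using assms by (subst lborel_integral_real_affine[of "-1" _ 0]) simp_all
  then show ?thesis by simp
qed

lemma integral_even_real:
  fixes F :: "real \<Rightarrow> complex"
  assumes F: "integrable lborel F" and even: "\<And>t. F (- t) = F t"
  shows "(\<integral>t. F t \<partial>lborel) = 2 * (LBINT t:{0<..}. F t)"
proof -
  have [measurable]: "F \<in> borel_measurable borel" using F by auto
  have i: "integrable lborel (\<lambda>t. indicat_real A t *\<^sub>R F t)" if "A \<in> sets borel" for A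
    using F that by (intro integrable_mult_indicator) auto
  have "(\<integral>t. F t \<partial>lborel) = (\<integral>t. indicat_real {0<..} t *\<^sub>R F t + indicat_real {..<0} t *\<^sub>R F t \<partial>lborel)"
  proof (rule integral_cong_AE)
    show "AE t in lborel. F t = indicat_real {0<..} t *\<^sub>R F t + indicat_real {..<0} t *\<^sub>R F t"
      using AE_lborel_singleton[of 0] by eventually_elim (auto simp: indicator_def)
  qed auto
  also have "\<dots> = (\<integral>t. indicat_real {0<..} t *\<^sub>R F t \<partial>lborel) + (\<integral>t. indicat_real {..<0} t *\<^sub>R F t \<partial>lborel)"
    by (intro Bochner_Integration.integral_add i) auto
  also have "(\<integral>t. indicat_real {..<0} t *\<^sub>R F t \<partial>lborel) = (\<integral>t. indicat_real {0<..} t *\<^sub>R F t \<partial>lborel)"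
    by (subst lborel_integral_real_affine[of "-1" _ 0]) (auto simp: even indicator_def)
  finally show ?thesis by (simp add: set_lebesgue_integral_def)
qed

text \<open>By evenness it is enough to integrate over (0, 1). There t = (1 + u) powr (-1/2) gives 1
  - t^2 = u / (1 + u) and |dt| = 1/2 * (1 + u) powr (-3/2) du. The moment becomes the beta integral
  on the half line at x = 1, with total exponent \<nu> + n + 3/2 of 1 + u.\<close>

lemma legendre_weight_even_moment:
  assumes "Re \<nu> > -1"
  shows "(\<integral>t. legendre_weight \<nu> t * of_real t ^ (2 * n) \<partial>lborel) =
           Gamma (\<nu> + 1) * Gamma (of_nat n + 1/2) / Gamma (\<nu> + of_nat n + 3/2)"
proof -
  define f where "f t = legendre_weight \<nu> t * of_real t ^ (2 * n)" for t
  define g :: "real \<Rightarrow> real" where "g u = (1 + u) powr (-1/2)" for u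
  define h :: "real \<Rightarrow> real" where "h u = -1/2 * (1 + u) powr (-3/2)" for u
  have [measurable]: "f \<in> borel_measurable borel" unfolding f_def by measurable
  have f: "integrable lborel f"
    unfolding f_def
  proof (rule integrable_legendre_weight_mult[where C = 1])
    show "norm (complex_of_real t ^ (2 * n)) \<le> 1" if "t \<in> {-1<..<1}" for t
      using that by (auto simp: norm_power intro!: power_le_one)
  qed (use assms in auto)
  have g2: "(g u)\<^sup>2 = 1 / (1 + u)" if "u > 0" for u
  proof -
    have "(g u)\<^sup>2 = (1 + u) powr (-1)"
      by (simp add: g_def power2_eq_square flip: powr_add)
    then show ?thesis using that by (simp add: powr_minus_divide)
  qed
  have img: "g ` {0<..} = {0<..<1}"
  proof (intro equalityI subsetI)
    fix t :: real assume "t \<in> {0<..<1}"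
    then have t: "0 < t" "t < 1" by auto
    have "t = g (t powr (-2) - 1)" using t by (simp add: g_def powr_powr)
    moreover have "t powr (-2) > 1" using t powr_less_mono'[of t "-2" 0] by simp
    ultimately show "t \<in> g ` {0<..}" by (intro image_eqI) auto
  next
    fix t assume "t \<in> g ` {0<..}"
    then obtain u where u: "u > 0" "t = g u" by auto
    have "t\<^sup>2 < 1" using u g2[OF u(1)] by simp
    moreover have "t > 0" using u by (simp add: g_def)
    ultimately show "t \<in> {0<..<1}" using abs_square_less_1[of t] by simp
  qed
  have inj: "inj_on g {0<..}"
  proof (rule inj_onI)
    fix x y assume *: "x \<in> {0<..}" "y \<in> {0<..}" "g x = g y"
    have "1 / (1 + x) = (g x)\<^sup>2" using g2[of x] *(1) by simp
    also have "\<dots> = 1 / (1 + y)" unfolding *(3) using g2[of y] *(2) by simp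
    finally show "x = y" using *(1,2) by (simp add: frac_eq_eq)
  qed
  have sub: "(LBINT u:{0<..}. \<bar>h u\<bar> *\<^sub>R f (g u)) = (LBINT t:{0<..<1}. f t)"
    unfolding img[symmetric]
  proof (rule set_lborel_change_of_variables(2))
    show "(g has_field_derivative h u) (at u)" if "u \<in> {0<..}" for u
      unfolding g_def h_def using that by (auto intro!: derivative_eq_intros)
    show "set_integrable lborel (g ` {0<..}) f"
      unfolding set_integrable_def img using f by (intro integrable_mult_indicator) auto
    show "g ` {0<..} \<in> sets borel" unfolding img by simp
    show "g \<in> borel_measurable borel" "h \<in> borel_measurable borel"
      unfolding g_def h_def by measurable
  qed (simp_all add: inj)
  define s where "s = \<nu> + of_nat n + 3/2"
  have pw: "\<bar>h u\<bar> *\<^sub>R f (g u) = 1/2 * (gamma_weight (\<nu> + 1) u * of_real (1 + u) powr (- s))" if u: "u > 0" for u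
  proof -
    have gu: "g u \<in> {0<..<1}" using img u by auto
    have "1 - (g u)\<^sup>2 = u / (1 + u)" using u by (simp add: g2 field_simps)
    then have "legendre_weight \<nu> (g u) = of_real u powr \<nu> * of_real (1 + u) powr (- \<nu>)"
      using gu u of_real_powr_divide[of u "1 + u" \<nu>] by (simp add: legendre_weight_def)
    moreover have "complex_of_real (g u) ^ (2 * n) = of_real (1 + u) powr (- of_nat n)"
    proof -
      have "complex_of_real (g u) ^ (2 * n) = of_real ((1 / (1 + u)) ^ n)"
        using u by (simp only: power_mult g2 flip: of_real_power)
      also have "\<dots> = of_real (1 + u) powr (- of_nat n)"
        using u by (simp add: powr_minus powr_nat' power_one_over field_simps complex_eq_iff[of _ 0])
      finally show ?thesis .
    qed
    moreover have "complex_of_real \<bar>h u\<bar> = 1/2 * of_real (1 + u) powr (- (3/2))"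
      using u powr_of_real[of "1 + u" "- (3/2)"] by (simp add: h_def)
    moreover have "of_real (1 + u) powr (- s) =
        of_real (1 + u) powr (- \<nu>) * of_real (1 + u) powr (- of_nat n) * of_real (1 + u) powr (- (3/2) :: complex)"
      by (simp add: s_def flip: powr_add)
    ultimately show ?thesis using u
      by (simp add: f_def scaleR_conv_of_real gamma_weight_def)
  qed
  have "(\<integral>t. f t \<partial>lborel) = 2 * (LBINT t:{0<..}. f t)"
    by (rule integral_even_real[OF f]) (simp add: f_def)
  also have "(LBINT t:{0<..}. f t) = (LBINT t:{0<..<1}. f t)"
    unfolding set_lebesgue_integral_def
    by (rule Bochner_Integration.integral_cong) (auto simp: f_def legendre_weight_def indicator_def)
  also have "\<dots> = (\<integral>u. 1/2 * (gamma_weight (\<nu> + 1) u * of_real (1 + u) powr (- s)) \<partial>lborel)"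
    unfolding sub[symmetric] unfolding set_lebesgue_integral_def
    by (rule Bochner_Integration.integral_cong) (auto simp: pw indicator_def gamma_weight_def)
  also have "\<dots> = 1/2 * (\<integral>u. gamma_weight (\<nu> + 1) u * of_real (1 + u) powr (- s) \<partial>lborel)"
    by (rule integral_mult_right_zero)
  also have "(\<integral>u. gamma_weight (\<nu> + 1) u * of_real (1 + u) powr (- s) \<partial>lborel) =
      Gamma (\<nu> + 1) * Gamma (s - (\<nu> + 1)) / Gamma s"
    using has_bochner_integral_integral_eq[OF has_bochner_integral_Beta_halfline[of "\<nu> + 1" s 1]] assms
    by (simp add: s_def)
  finally show ?thesis by (simp add: f_def s_def)
qed

section \<open>The Euler integral and its expansion at infinity\<close>

definition euler_legendre :: "complex \<Rightarrow> complex \<Rightarrow> complex \<Rightarrow> complex" where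
  "euler_legendre \<nu> s z = (\<integral>t. legendre_weight \<nu> t * (z - of_real t) powr (- s) \<partial>lborel)"

lemma legendre_domain_iff: "z \<in> legendre_domain \<longleftrightarrow> Im z \<noteq> 0 \<or> Re z > 1"
  by (auto simp: legendre_domain_def complex_eq_iff image_iff not_le)

text \<open>Principal logarithms need not add. Here they do: along the segment from 0 to t neither z
  - x nor 1 - x / z meets the branch cut, so Ln (z - x) - Ln (1 - x / z) has derivative 0 and keeps
  its value Ln z at x = 0.\<close>

lemma powr_diff_factor:
  fixes z w :: complex and t :: real
  assumes z: "z \<in> legendre_domain" "norm z > 1" and t: "\<bar>t\<bar> \<le> 1"
  shows "(z - of_real t) powr w = z powr w * (1 - of_real t / z) powr w"
proof -
  let ?f = "\<lambda>x. Ln (z - x) - Ln (1 - x / z)"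
  have z0: "z \<noteq> 0" using z(2) by auto
  have seg: "\<exists>r. x = of_real r \<and> \<bar>r\<bar> \<le> 1" if "x \<in> closed_segment 0 (of_real t)" for x :: complex
  proof -
    obtain u where "x = of_real (u * t)" "0 \<le> u" "u \<le> 1"
      using \<open>x \<in> _\<close> by (auto simp: closed_segment_def scaleR_conv_of_real)
    then show ?thesis using t by (auto simp: abs_mult intro!: exI[of _ "u * t"] mult_le_one)
  qed
  have s1: "z - x \<notin> \<real>\<^sub>\<le>\<^sub>0" "1 - x / z \<notin> \<real>\<^sub>\<le>\<^sub>0" if x: "x \<in> closed_segment 0 (of_real t)" for x
  proof -
    obtain r where r: "x = of_real r" "\<bar>r\<bar> \<le> 1" using seg[OF x] by auto
    show "z - x \<notin> \<real>\<^sub>\<le>\<^sub>0" using z(1) r by (auto simp: complex_nonpos_Reals_iff legendre_domain_iff)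
    have "norm (x / z) < 1" using r z(2) z0 by (simp add: norm_divide divide_less_eq)
    then have "Re (x / z) < 1" using complex_Re_le_cmod[of "x / z"] by linarith
    then show "1 - x / z \<notin> \<real>\<^sub>\<le>\<^sub>0" by (auto simp: complex_nonpos_Reals_iff)
  qed
  have "(?f has_field_derivative 0) (at x within closed_segment 0 (of_real t))"
    if x: "x \<in> closed_segment 0 (of_real t)" for x
  proof -
    have "z - x \<noteq> 0" using s1(1)[OF x] by auto
    then show ?thesis using s1[OF x] z0
      by (auto intro!: derivative_eq_intros simp: field_simps)
  qed
  then obtain c where "\<And>x. x \<in> closed_segment 0 (of_real t) \<Longrightarrow> ?f x = c"
    using has_field_derivative_zero_constant[OF convex_closed_segment, of 0 "of_real t" ?f] by blast
  from this[of 0] this[of "of_real t"] have "Ln (z - of_real t) = Ln z + Ln (1 - of_real t / z)"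
    by (simp add: diff_eq_eq)
  moreover have "z - of_real t \<noteq> 0" "1 - of_real t / z \<noteq> 0" using s1[of "of_real t"] by auto
  ultimately show ?thesis using z0 by (simp add: powr_def exp_add ring_distribs)
qed

text \<open>Odd moments vanish, which leaves a series in 1 / z^2. The duplication formulas split
  \<open>pochhammer s (2 * n)\<close> into the two halved parameters and write (2n)! as 4^n (1/2)_n
  n!. The factor (1/2)_n cancels against Gamma (n + 1/2) from the even moment, leaving sqrt
  pi.\<close>

lemma euler_legendre_series:
  assumes z: "z \<in> legendre_domain" "norm z > 1" and \<nu>: "Re \<nu> > -1"
  shows "euler_legendre \<nu> s z = of_real (sqrt pi) * Gamma (\<nu> + 1) * z powr (- s) *
           hypergeo_reg_2F1 (s / 2) ((s + 1) / 2) (\<nu> + 3/2) (1 / z\<^sup>2)"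
proof -
  define c where "c n = pochhammer s n / fact n" for n
  have binom: "(\<lambda>n. c n * x ^ n) sums (1 - x) powr (- s)" if "norm x < 1" for x
    using gen_binomial_complex[of "- x" "- s"] that
    by (simp add: c_def gbinomial_pochhammer power_minus[of x] mult_ac)
  define f where "f n t = legendre_weight \<nu> t * (c n * (of_real t / z) ^ n)" for n t
  have z0: "z \<noteq> 0" using z(2) by auto
  \<comment> \<open>The terms at t = 1 dominate those at every t in the interval, so this one series
    justifies integrating term by term. Absolute convergence at 1 / z follows from convergence at
    \<open>x\<close>, whose modulus is the midpoint between that of 1 / z and 1.\<close>
  have sum_c: "summable (\<lambda>n. norm (c n * (1 / z) ^ n))"
  proof (rule powser_insidea)
    define y where "y = norm (1 / z)"
    define x :: complex where "x = of_real ((1 + y) / 2)"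
    have y: "0 \<le> y" "y < 1" using z(2) z0 by (simp_all add: y_def norm_divide divide_less_eq)
    have "norm x = (1 + y) / 2"
      unfolding x_def norm_of_real using y by simp
    with y have "norm x < 1" "norm (1 / z) < norm x"
      unfolding y_def[symmetric] by simp_all
    then show "summable (\<lambda>n. c n * x ^ n)" "norm (1 / z) < norm x"
      using binom[of x] by (auto simp: sums_iff)
  qed
  have le: "norm (f n t) \<le> norm (legendre_weight \<nu> t) * norm (c n * (1 / z) ^ n)" for n t
  proof (cases "t \<in> {-1<..<1}")
    case True
    then have "\<bar>t\<bar> ^ n \<le> 1" by (intro power_le_one) auto
    then show ?thesis
      by (auto simp: f_def norm_mult norm_power norm_divide power_divide intro!: mult_left_mono divide_right_mono mult_left_le)
  qed (simp add: f_def legendre_weight_def)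
  have int: "integrable lborel (f n)" for n
    by (rule Bochner_Integration.integrable_bound[of _ "\<lambda>t. norm (legendre_weight \<nu> t) * norm (c n * (1 / z) ^ n)"])
      (use le integrable_legendre_weight[OF \<nu>] in \<open>auto simp: f_def[abs_def] intro!: AE_I2 integrable_mult_left integrable_norm\<close>)
  have "(\<lambda>n. \<integral>t. f n t \<partial>lborel) sums (\<integral>t. (\<Sum>n. f n t) \<partial>lborel)"
  proof (rule sums_integral)
    show "AE t in lborel. summable (\<lambda>n. norm (f n t))"
      by (intro AE_I2 summable_comparison_test'[OF summable_mult[OF sum_c]])
        (use le in \<open>auto\<close>)
    show "summable (\<lambda>n. \<integral>t. norm (f n t) \<partial>lborel)"
    proof (rule summable_comparison_test'[OF summable_mult[OF sum_c]])
      fix n :: nat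
      have "(\<integral>t. norm (f n t) \<partial>lborel) \<le> (\<integral>t. norm (legendre_weight \<nu> t) * norm (c n * (1 / z) ^ n) \<partial>lborel)"
        by (intro integral_mono integrable_norm int le integrable_mult_left integrable_legendre_weight \<nu>)
      then show "norm (\<integral>t. norm (f n t) \<partial>lborel) \<le> (\<integral>t. norm (legendre_weight \<nu> t) \<partial>lborel) * norm (c n * (1 / z) ^ n)"
        by simp
    qed
  qed (use int in auto)
  moreover have "(\<Sum>n. f n t) = legendre_weight \<nu> t * (1 - of_real t / z) powr (- s)" for t
  proof (cases "t \<in> {-1<..<1}")
    case True
    then have "\<bar>t\<bar> < norm z" using z(2) by auto
    then have "norm (of_real t / z) < 1" using z0 by (simp add: norm_divide divide_less_eq)
    from sums_mult[OF binom[OF this]] show ?thesis by (simp add: f_def sums_iff)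
  qed (simp add: f_def legendre_weight_def)
  ultimately have S: "(\<lambda>n. \<integral>t. f n t \<partial>lborel) sums
      (\<integral>t. legendre_weight \<nu> t * (1 - of_real t / z) powr (- s) \<partial>lborel)"
    by (simp only:)
  have fn: "(\<integral>t. f n t \<partial>lborel) = c n / z ^ n * (\<integral>t. legendre_weight \<nu> t * of_real t ^ n \<partial>lborel)" for n
  proof -
    have "(\<integral>t. f n t \<partial>lborel) = (\<integral>t. c n / z ^ n * (legendre_weight \<nu> t * of_real t ^ n) \<partial>lborel)"
      by (rule Bochner_Integration.integral_cong) (simp_all add: f_def power_divide)
    then show ?thesis by simp
  qed
  have even: "(\<integral>t. f (2 * n) t \<partial>lborel) = of_real (sqrt pi) * Gamma (\<nu> + 1) *
      (pochhammer (s / 2) n * pochhammer ((s + 1) / 2) n * rGamma (\<nu> + 3/2 + of_nat n) * (1 / z\<^sup>2) ^ n / fact n)" for n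
  proof -
    have half: "(1/2 :: complex) \<notin> \<int>\<^sub>\<le>\<^sub>0"
    proof
      assume "(1/2 :: complex) \<in> \<int>\<^sub>\<le>\<^sub>0"
      then obtain k where "(1/2 :: complex) = of_int k" "k \<le> 0" by (elim nonpos_Ints_cases)
      from arg_cong[OF this(1), of Re] this(2) show False by simp
    qed
    have "Gamma (of_nat n + 1/2 :: complex) = pochhammer (1/2) n * of_real (sqrt pi)"
      using pochhammer_Gamma[of "1/2 :: complex" n] Gamma_one_half_complex
      by (simp add: half add.commute)
    moreover have "pochhammer s (2 * n) = 2 ^ (2 * n) * pochhammer (s / 2) n * pochhammer ((s + 1) / 2) n"
      using pochhammer_double[of "s / 2" n] by (simp add: add_divide_distrib)
    moreover have "pochhammer (1/2 :: complex) n \<noteq> 0"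
      using fact_double[of n, where 'a = complex] by auto
    moreover have cancel: "A * p * q / (A * h * N) / Z * (G * (h * r) / Y) = r * G * (p * q * inverse Y * inverse Z / N)"
      if "A \<noteq> 0" "h \<noteq> 0" "N \<noteq> 0" "Y \<noteq> 0" "Z \<noteq> 0" for A p q h N Z G r Y :: complex
      using that by (simp add: field_simps)
    moreover have "Gamma (\<nu> + of_nat n + 3/2) \<noteq> 0"
      using \<nu> by (intro Gamma_nonzero_if_Re_pos) simp
    moreover have "inverse (z ^ (2 * n)) = (1 / z\<^sup>2) ^ n"
      by (simp add: power_mult power_one_over inverse_eq_divide)
    moreover have "rGamma (\<nu> + 3/2 + of_nat n) = inverse (Gamma (\<nu> + of_nat n + 3/2))"
      by (simp add: rGamma_inverse_Gamma add_ac)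
    ultimately show ?thesis
      using cancel[of "2 ^ (2 * n)" "pochhammer (1/2) n" "fact n" "Gamma (\<nu> + of_nat n + 3/2)" "z ^ (2 * n)"
          "pochhammer (s / 2) n" "pochhammer ((s + 1) / 2) n" "Gamma (\<nu> + 1)" "of_real (sqrt pi)"] z0
      unfolding fn c_def fact_double legendre_weight_even_moment[OF \<nu>] by simp
  qed
  from S have "(\<lambda>n. \<integral>t. f (2 * n) t \<partial>lborel) sums
      (\<integral>t. legendre_weight \<nu> t * (1 - of_real t / z) powr (- s) \<partial>lborel)"
    by (subst sums_mono_reindex[of "\<lambda>n. 2 * n"])
      (auto simp: strict_mono_def fn legendre_weight_odd_moment elim!: evenE intro!: legendre_weight_odd_moment)
  then have K: "(\<lambda>n. of_real (sqrt pi) * Gamma (\<nu> + 1) *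
      (pochhammer (s / 2) n * pochhammer ((s + 1) / 2) n * rGamma (\<nu> + 3/2 + of_nat n) * (1 / z\<^sup>2) ^ n / fact n)) sums
      (\<integral>t. legendre_weight \<nu> t * (1 - of_real t / z) powr (- s) \<partial>lborel)"
    by (simp only: even)
  have "Gamma (\<nu> + 1) \<noteq> 0"
    using \<nu> by (intro Gamma_nonzero_if_Re_pos) simp
  \<comment> \<open>Dividing by this nonzero constant gives the summability of the hypergeometric
    terms themselves, needed to pull the constant out of the sum.\<close>
  then have K0: "of_real (sqrt pi) * Gamma (\<nu> + 1) \<noteq> 0" by simp
  have "(\<integral>t. legendre_weight \<nu> t * (1 - of_real t / z) powr (- s) \<partial>lborel) =
      of_real (sqrt pi) * Gamma (\<nu> + 1) * hypergeo_reg_2F1 (s / 2) ((s + 1) / 2) (\<nu> + 3/2) (1 / z\<^sup>2)"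
    unfolding hypergeo_reg_2F1_def sums_unique[OF K]
    by (rule suminf_mult[OF summable_mult_D[OF sums_summable[OF K] K0]])
  moreover have "euler_legendre \<nu> s z = (\<integral>t. z powr (- s) * (legendre_weight \<nu> t * (1 - of_real t / z) powr (- s)) \<partial>lborel)"
    unfolding euler_legendre_def
  proof (rule Bochner_Integration.integral_cong)
    fix t :: real
    show "legendre_weight \<nu> t * (z - of_real t) powr (- s) = z powr (- s) * (legendre_weight \<nu> t * (1 - of_real t / z) powr (- s))"
    proof (cases "t \<in> {-1<..<1}")
      case True
      then have "(z - of_real t) powr (- s) = z powr (- s) * (1 - of_real t / z) powr (- s)"
        by (intro powr_diff_factor z) auto
      then show ?thesis by simp
    qed (simp add: legendre_weight_def)
  qed simp
  ultimately show ?thesis by simp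
qed

subsection \<open>Estimates and holomorphy on the cut plane\<close>

lemma open_legendre_domain: "open legendre_domain"
  unfolding legendre_domain_def using closed_slot_left[of 1] by (simp add: open_Compl)

lemma connected_legendre_domain: "connected legendre_domain"
  unfolding legendre_domain_def by (intro starlike_imp_connected starlike_slotted_complex_plane_left)

lemma legendre_domain_add: "z \<in> legendre_domain \<Longrightarrow> u \<ge> 0 \<Longrightarrow> z + of_real u \<in> legendre_domain"
  by (auto simp: legendre_domain_iff)

lemma legendre_domain_diff_notin: "z \<in> legendre_domain \<Longrightarrow> t \<le> 1 \<Longrightarrow> z - of_real t \<notin> \<real>\<^sub>\<le>\<^sub>0"
  by (auto simp: legendre_domain_iff complex_nonpos_Reals_iff)

text \<open>Since \<open>(z + u - t) / (1 + u)\<close> lies on the segment from \<open>1\<close> to \<open>z - t\<close>, its modulus is bounded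
  below by compactness.\<close>

lemma powr_shift_bound:
  assumes K: "compact K" "K \<subseteq> legendre_domain" and s: "Re s \<ge> 0"
  obtains C where "\<And>z u t. z \<in> K \<Longrightarrow> u \<ge> 0 \<Longrightarrow> \<bar>t\<bar> \<le> 1 \<Longrightarrow>
    norm ((z + of_real u - of_real t) powr (- s)) \<le> C * (1 + u) powr (- Re s)"
proof (cases "K = {}")
  case False
  \<comment> \<open>With l = 1 / (1 + u), \<open>h\<close> is (z + u - t) / (1 + u). The unbounded
    range of u becomes l in (0, 1]; adding l = 0, where \<open>h\<close> is 1, makes the parameter
    set compact.\<close>
  define h :: "complex \<times> real \<times> real \<Rightarrow> complex"
    where "h = (\<lambda>(z, t, l). of_real l * (z - of_real t) + of_real (1 - l))"
  define T where "T = K \<times> {-1..1::real} \<times> {0..1::real}"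
  have "compact T" "T \<noteq> {}"
    using K False by (auto simp: T_def intro!: compact_Times)
  moreover have "continuous_on T (\<lambda>p. norm (h p))"
    unfolding h_def case_prod_unfold by (intro continuous_intros)
  ultimately obtain p where p: "p \<in> T" "\<And>q. q \<in> T \<Longrightarrow> norm (h p) \<le> norm (h q)"
    using continuous_attains_inf by metis
  \<comment> \<open>A zero would force l * Im z = 0. For l = 0 the value is 1; for l > 0 and real z,
    the real part is positive because z > 1 and t does not exceed 1.\<close>
  have "h q \<noteq> 0" if q: "q \<in> T" for q
  proof
    obtain z t l where q': "q = (z, t, l)" "z \<in> legendre_domain" "\<bar>t\<bar> \<le> 1" "0 \<le> l" "l \<le> 1"
      using q K by (cases q) (auto simp: T_def)
    assume "h q = 0"
    then have "l * Im z = 0" "l * (Re z - t) + (1 - l) = 0"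
      by (auto simp: h_def q' complex_eq_iff)
    moreover have "l * (Re z - t) > 0" if "l > 0" "Im z = 0"
      using that q' by (auto simp: legendre_domain_iff)
    ultimately show False using q' by (cases "l = 0") auto
  qed
  with p(1) have c: "norm (h p) > 0" by simp
  show ?thesis
  proof (rule that)
    fix z u t assume z: "z \<in> K" "u \<ge> (0::real)" "\<bar>t\<bar> \<le> (1::real)"
    let ?w = "z + of_real u - of_real t"
    have "(z, t, 1 / (1 + u)) \<in> T" using z by (auto simp: T_def)
    then have "norm (h p) \<le> norm (h (z, t, 1 / (1 + u)))" by (rule p(2))
    also have "h (z, t, 1 / (1 + u)) = ?w / of_real (1 + u)"
    proof -
      have "1 - 1 / (1 + u) = u / (1 + u)" using z(2) by (simp add: field_simps)
      then have "h (z, t, 1 / (1 + u)) = (z - of_real t) / of_real (1 + u) + of_real u / of_real (1 + u)"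
        by (simp add: h_def del: of_real_add of_real_diff)
      then show ?thesis by (simp add: add_divide_distrib diff_divide_distrib del: of_real_add)
    qed
    also have "norm \<dots> = norm ?w / (1 + u)" using z(2) by (simp add: norm_divide del: of_real_add)
    finally have le: "norm (h p) * (1 + u) \<le> norm ?w" using z(2) by (simp add: le_divide_eq)
    \<comment> \<open>A nonreal exponent contributes a factor depending on the argument, which is
      bounded because \<open>Arg\<close> is. The lower bound on the modulus becomes an upper bound
      on its power since Re s is nonnegative.\<close>
    have "norm (?w powr (- s)) = norm ?w powr (- Re s) * exp (Im s * Arg ?w)"
      by (simp add: norm_powr_complex)
    also have "\<dots> \<le> (norm (h p) * (1 + u)) powr (- Re s) * exp (\<bar>Im s\<bar> * pi)"
    proof (intro mult_mono)
      show "norm ?w powr (- Re s) \<le> (norm (h p) * (1 + u)) powr (- Re s)"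
        using le c s z(2) by (intro powr_mono2') auto
      have "Im s * Arg ?w \<le> \<bar>Im s\<bar> * \<bar>Arg ?w\<bar>" by (metis abs_ge_self abs_mult)
      also have "\<dots> \<le> \<bar>Im s\<bar> * pi" using Arg_bounded[of ?w] by (intro mult_left_mono) auto
      finally show "exp (Im s * Arg ?w) \<le> exp (\<bar>Im s\<bar> * pi)" by simp
    qed auto
    also have "\<dots> = norm (h p) powr (- Re s) * exp (\<bar>Im s\<bar> * pi) * (1 + u) powr (- Re s)"
      using z(2) by (simp add: powr_mult)
    finally show "norm (?w powr (- s)) \<le> norm (h p) powr (- Re s) * exp (\<bar>Im s\<bar> * pi) * (1 + u) powr (- Re s)" .
  qed
qed (use that in auto)

lemma norm_legendre_weight_mult_le:
  assumes "\<bar>t\<bar> \<le> 1 \<Longrightarrow> norm w \<le> C"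
  shows "norm (legendre_weight \<nu> t * w) \<le> norm (legendre_weight \<nu> t) * C"
proof (cases "\<bar>t\<bar> \<le> 1")
  case True
  then show ?thesis using assms by (simp add: norm_mult mult_left_mono)
next
  case False
  then have "legendre_weight \<nu> t = 0" by (auto simp: legendre_weight_def indicator_def)
  then show ?thesis by simp
qed

lemma holomorphic_on_euler_legendre:
  assumes \<nu>: "Re \<nu> > -1" and s: "Re s \<ge> 0"
  shows "euler_legendre \<nu> s holomorphic_on legendre_domain"
  unfolding euler_legendre_def
proof (rule holomorphic_on_integral[OF open_legendre_domain])
  fix t :: real
  show "(\<lambda>z. legendre_weight \<nu> t * (z - of_real t) powr (- s)) holomorphic_on legendre_domain"
  proof (cases "t \<le> 1")
    case True
    then show ?thesis using legendre_domain_diff_notin by (intro holomorphic_intros) auto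
  qed (simp add: legendre_weight_def)
next
  fix z assume "z \<in> legendre_domain"
  then obtain r where r: "r > 0" "cball z r \<subseteq> legendre_domain"
    using open_legendre_domain open_contains_cball by blast
  obtain C where C: "\<And>z' u t. z' \<in> cball z r \<Longrightarrow> u \<ge> 0 \<Longrightarrow> \<bar>t\<bar> \<le> 1 \<Longrightarrow>
      norm ((z' + of_real u - of_real t) powr (- s)) \<le> C * (1 + u) powr (- Re s)"
    using powr_shift_bound[OF compact_cball r(2) s] by blast
  have "norm (legendre_weight \<nu> t * (w - of_real t) powr (- s)) \<le> norm (legendre_weight \<nu> t) * C"
    if "w \<in> cball z r" for w t
    using C[OF that, of 0 t] by (intro norm_legendre_weight_mult_le) auto
  then show "\<exists>r>0. cball z r \<subseteq> legendre_domain \<and> (\<exists>g. integrable lborel g \<and>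
      (\<forall>w\<in>cball z r. \<forall>t\<in>space lborel. norm (legendre_weight \<nu> t * (w - of_real t) powr (- s)) \<le> g t))"
    using r integrable_legendre_weight[OF \<nu>]
    by (intro exI[of _ r] conjI exI[of _ "\<lambda>t. norm (legendre_weight \<nu> t) * C"])
      (auto intro!: integrable_mult_left integrable_norm)
qed measurable

lemma integrable_euler_legendre:
  assumes \<nu>: "Re \<nu> > -1" and s: "Re s \<ge> 0" and z: "z \<in> legendre_domain"
  shows "integrable lborel (\<lambda>t. legendre_weight \<nu> t * (z - of_real t) powr (- s))"
proof -
  obtain C where C: "\<And>z' u t. z' \<in> {z} \<Longrightarrow> u \<ge> 0 \<Longrightarrow> \<bar>t\<bar> \<le> 1 \<Longrightarrow>
      norm ((z' + of_real u - of_real t) powr (- s)) \<le> C * (1 + u) powr (- Re s)"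
    using powr_shift_bound[of "{z}" s] z s by auto
  show ?thesis
    by (rule integrable_legendre_weight_mult[OF \<nu>, where C = C]) (use C[of z 0] in auto)
qed

section \<open>Convergence and holomorphy of the integral over shifts\<close>

lemma euler_legendre_shift_measurable [measurable]:
  "(\<lambda>u. euler_legendre \<nu> s (z + of_real u)) \<in> borel_measurable borel"
  unfolding euler_legendre_def by measurable

text \<open>The function is the modulus of the integrand of
  \<open>has_bochner_integral_Beta_halfline\<close> at x = 1.\<close>

lemma integrable_gamma_weight_tail:
  assumes "0 < Re a" "Re a < Re s"
  shows "integrable lborel (\<lambda>u. norm (gamma_weight a u) * (1 + u) powr (- Re s))"
proof -
  have "integrable lborel (\<lambda>u. norm (gamma_weight a u * of_real (1 + u) powr (- s)))"
    using has_bochner_integral_Beta_halfline[of a s 1] assms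
    by (intro integrable_norm) (simp add: has_bochner_integral_iff)
  also have "(\<lambda>u. norm (gamma_weight a u * of_real (1 + u) powr (- s))) =
      (\<lambda>u. norm (gamma_weight a u) * (1 + u) powr (- Re s))"
  proof
    fix u :: real
    show "norm (gamma_weight a u * of_real (1 + u) powr (- s)) = norm (gamma_weight a u) * (1 + u) powr (- Re s)"
      using norm_powr_real_powr[of "of_real (1 + u)" "- s"]
      by (cases "u > 0") (simp_all add: norm_mult gamma_weight_def)
  qed
  finally show ?thesis .
qed

text \<open>A single majorant in u for all z in \<open>K\<close>: with \<open>K\<close> a point it
  gives convergence of the integral over u, with \<open>K\<close> a closed disc its holomorphy in
  z.\<close>

lemma euler_legendre_shift_bound:
  assumes \<nu>: "Re \<nu> > -1" and s: "Re s \<ge> 0" and K: "compact K" "K \<subseteq> legendre_domain"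
  obtains C where "\<And>z u. z \<in> K \<Longrightarrow>
    norm (gamma_weight a u * euler_legendre \<nu> s (z + of_real u)) \<le> C * (norm (gamma_weight a u) * (1 + u) powr (- Re s))"
proof -
  obtain C where C: "\<And>z u t. z \<in> K \<Longrightarrow> u \<ge> 0 \<Longrightarrow> \<bar>t\<bar> \<le> 1 \<Longrightarrow>
      norm ((z + of_real u - of_real t) powr (- s)) \<le> C * (1 + u) powr (- Re s)"
    using powr_shift_bound[OF K s] by blast
  show ?thesis
  proof (rule that)
    fix z u assume z: "z \<in> K"
    show "norm (gamma_weight a u * euler_legendre \<nu> s (z + of_real u)) \<le>
        ((\<integral>t. norm (legendre_weight \<nu> t) \<partial>lborel) * C) * (norm (gamma_weight a u) * (1 + u) powr (- Re s))"
    proof (cases "u > 0")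
      case True
      then have zu: "z + of_real u \<in> legendre_domain" using z K by (auto intro: legendre_domain_add)
      have "norm (euler_legendre \<nu> s (z + of_real u)) \<le>
          (\<integral>t. norm (legendre_weight \<nu> t * (z + of_real u - of_real t) powr (- s)) \<partial>lborel)"
        unfolding euler_legendre_def by (rule integral_norm_bound)
      also have "\<dots> \<le> (\<integral>t. norm (legendre_weight \<nu> t) * (C * (1 + u) powr (- Re s)) \<partial>lborel)"
        using True z C by (intro integral_mono integrable_norm integrable_euler_legendre \<nu> s zu
          integrable_mult_left integrable_legendre_weight norm_legendre_weight_mult_le) auto
      also have "\<dots> = (\<integral>t. norm (legendre_weight \<nu> t) \<partial>lborel) * (C * (1 + u) powr (- Re s))" by simp
      finally have "norm (gamma_weight a u) * norm (euler_legendre \<nu> s (z + of_real u)) \<le>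
          norm (gamma_weight a u) * ((\<integral>t. norm (legendre_weight \<nu> t) \<partial>lborel) * (C * (1 + u) powr (- Re s)))"
        by (rule mult_left_mono) simp
      then show ?thesis by (simp only: norm_mult mult_ac)
    qed (simp add: gamma_weight_def)
  qed
qed

lemma integrable_gamma_weight_euler_legendre:
  assumes "Re \<nu> > -1" "0 < Re a" "Re a < Re s" "z \<in> legendre_domain"
  shows "integrable lborel (\<lambda>u. gamma_weight a u * euler_legendre \<nu> s (z + of_real u))"
proof -
  obtain C where C: "\<And>z' u. z' \<in> {z} \<Longrightarrow> norm (gamma_weight a u * euler_legendre \<nu> s (z' + of_real u)) \<le>
      C * (norm (gamma_weight a u) * (1 + u) powr (- Re s))"
    using euler_legendre_shift_bound[of \<nu> s "{z}" a] assms by auto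
  show ?thesis
  proof (rule Bochner_Integration.integrable_bound)
    show "integrable lborel (\<lambda>u. C * (norm (gamma_weight a u) * (1 + u) powr (- Re s)))"
      using integrable_gamma_weight_tail assms by (intro integrable_mult_right) auto
    show "AE u in lborel. norm (gamma_weight a u * euler_legendre \<nu> s (z + of_real u)) \<le>
        norm (C * (norm (gamma_weight a u) * (1 + u) powr (- Re s)))"
      using C[of z] by (intro AE_I2) (force intro: order_trans[OF _ abs_ge_self])
  qed measurable
qed

lemma holomorphic_on_integral_euler_legendre:
  assumes "Re \<nu> > -1" "0 < Re a" "Re a < Re s"
  shows "(\<lambda>z. \<integral>u. gamma_weight a u * euler_legendre \<nu> s (z + of_real u) \<partial>lborel) holomorphic_on legendre_domain"
proof (rule holomorphic_on_integral[OF open_legendre_domain])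
  fix u :: real
  show "(\<lambda>z. gamma_weight a u * euler_legendre \<nu> s (z + of_real u)) holomorphic_on legendre_domain"
  proof (cases "u > 0")
    case True
    have "(euler_legendre \<nu> s \<circ> (\<lambda>z. z + of_real u)) holomorphic_on legendre_domain"
    proof (rule holomorphic_on_compose_gen)
      show "euler_legendre \<nu> s holomorphic_on legendre_domain"
        using assms by (intro holomorphic_on_euler_legendre) auto
      show "(\<lambda>z. z + of_real u) ` legendre_domain \<subseteq> legendre_domain"
        using True by (auto intro: legendre_domain_add)
    qed (intro holomorphic_intros)
    then show ?thesis by (intro holomorphic_intros) (simp add: o_def)
  qed (simp add: gamma_weight_def)
next
  fix z assume "z \<in> legendre_domain"
  then obtain r where r: "r > 0" "cball z r \<subseteq> legendre_domain"
    using open_legendre_domain open_contains_cball by blast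
  obtain C where C: "\<And>z' u. z' \<in> cball z r \<Longrightarrow> norm (gamma_weight a u * euler_legendre \<nu> s (z' + of_real u)) \<le>
      C * (norm (gamma_weight a u) * (1 + u) powr (- Re s))"
    using euler_legendre_shift_bound[of \<nu> s "cball z r" a] assms r(2) by auto
  have "integrable lborel (\<lambda>u. C * (norm (gamma_weight a u) * (1 + u) powr (- Re s)))"
    using integrable_gamma_weight_tail assms by (intro integrable_mult_right) auto
  with C r show "\<exists>r>0. cball z r \<subseteq> legendre_domain \<and> (\<exists>g. integrable lborel g \<and>
      (\<forall>w\<in>cball z r. \<forall>u\<in>space lborel. norm (gamma_weight a u * euler_legendre \<nu> s (w + of_real u)) \<le> g u))"
    by blast
qed measurable

subsection \<open>The fractional integral\<close>

text \<open>Under the integral over t, the integral over u is a beta integral with base point x - t,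
  positive because x is real and greater than 1. It lowers the exponent s by a.\<close>

lemma integral_euler_legendre_real:
  assumes \<nu>: "Re \<nu> > -1" and a: "0 < Re a" "Re a < Re s" and x: "x > 1"
  shows "(\<integral>u. gamma_weight a u * euler_legendre \<nu> s (of_real x + of_real u) \<partial>lborel) =
           Gamma a * Gamma (s - a) / Gamma s * euler_legendre \<nu> (s - a) (of_real x)"
proof -
  define F where "F u t = gamma_weight a u * (legendre_weight \<nu> t * (of_real x + of_real u - of_real t) powr (- s))" for u t
  have xD: "of_real x \<in> legendre_domain" using x by (simp add: legendre_domain_iff)
  have s: "Re s \<ge> 0" using a by simp
  obtain C where C: "\<And>z u t. z \<in> {of_real x} \<Longrightarrow> u \<ge> 0 \<Longrightarrow> \<bar>t\<bar> \<le> 1 \<Longrightarrow>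
      norm ((z + of_real u - of_real t) powr (- s)) \<le> C * (1 + u) powr (- Re s)"
    using powr_shift_bound[of "{of_real x}" s] xD s by auto
  \<comment> \<open>The bound is a product of a function of t and a function of u, both integrable,
    which yields integrability on the product space.\<close>
  have Fle: "norm (F u t) \<le> norm (legendre_weight \<nu> t) * (C * (norm (gamma_weight a u) * (1 + u) powr (- Re s)))" for u t
  proof (cases "u > 0")
    case True
    have "norm (legendre_weight \<nu> t * (of_real x + of_real u - of_real t) powr (- s)) \<le>
        norm (legendre_weight \<nu> t) * (C * (1 + u) powr (- Re s))"
      using True C[of "of_real x" u t] by (intro norm_legendre_weight_mult_le) auto
    from mult_left_mono[OF this, of "norm (gamma_weight a u)"] show ?thesis
      by (simp add: F_def norm_mult mult_ac)
  qed (simp add: F_def gamma_weight_def)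
  have wI: "integrable lborel (\<lambda>t. norm (legendre_weight \<nu> t) * c)" for c
    by (intro integrable_mult_left integrable_norm integrable_legendre_weight \<nu>)
  have [measurable]: "case_prod F \<in> borel_measurable (lborel \<Otimes>\<^sub>M lborel)"
    unfolding F_def[abs_def] by measurable
  have [measurable]: "F u \<in> borel_measurable lborel" for u
    unfolding F_def[abs_def] by measurable
  have inner: "integrable lborel (F u)" for u
    by (rule Bochner_Integration.integrable_bound[OF wI[of "C * (norm (gamma_weight a u) * (1 + u) powr (- Re s))"]])
      (use Fle[of u] in \<open>auto intro!: AE_I2 order_trans[OF _ abs_ge_self]\<close>)
  have "integrable (lborel \<Otimes>\<^sub>M lborel) (case_prod F)"
  proof (rule lborel_pair.Fubini_integrable)
    show "integrable lborel (\<lambda>u. \<integral>t. norm (case_prod F (u, t)) \<partial>lborel)"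
    proof (rule Bochner_Integration.integrable_bound)
      show "integrable lborel (\<lambda>u. (\<integral>t. norm (legendre_weight \<nu> t) \<partial>lborel) * (C * (norm (gamma_weight a u) * (1 + u) powr (- Re s))))"
        using integrable_gamma_weight_tail[OF a] by (intro integrable_mult_right)
      have "(\<integral>t. norm (F u t) \<partial>lborel) \<le>
          (\<integral>t. norm (legendre_weight \<nu> t) \<partial>lborel) * (C * (norm (gamma_weight a u) * (1 + u) powr (- Re s)))" for u
        using integral_mono[OF integrable_norm[OF inner] wI Fle, of u] by simp
      then show "AE u in lborel. norm (\<integral>t. norm (case_prod F (u, t)) \<partial>lborel) \<le>
          norm ((\<integral>t. norm (legendre_weight \<nu> t) \<partial>lborel) * (C * (norm (gamma_weight a u) * (1 + u) powr (- Re s))))"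
        by (intro AE_I2) (auto intro: order_trans[OF _ abs_ge_self])
    qed measurable
  qed (use inner in auto)
  from lborel_pair.Fubini_integral[OF this]
  have "(\<integral>u. (\<integral>t. F u t \<partial>lborel) \<partial>lborel) = (\<integral>t. (\<integral>u. F u t \<partial>lborel) \<partial>lborel)" by simp
  also have "(\<lambda>t. \<integral>u. F u t \<partial>lborel) = (\<lambda>t. Gamma a * Gamma (s - a) / Gamma s *
      (legendre_weight \<nu> t * (of_real x - of_real t) powr (- (s - a))))"
  proof
    fix t
    show "(\<integral>u. F u t \<partial>lborel) = Gamma a * Gamma (s - a) / Gamma s *
      (legendre_weight \<nu> t * (of_real x - of_real t) powr (- (s - a)))"
    proof (cases "t \<in> {-1<..<1}")
      case True
      have "(\<integral>u. F u t \<partial>lborel) = (\<integral>u. legendre_weight \<nu> t * (gamma_weight a u * of_real (x - t + u) powr (- s)) \<partial>lborel)"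
        by (rule Bochner_Integration.integral_cong) (simp_all add: F_def algebra_simps)
      also have "\<dots> = legendre_weight \<nu> t * (Gamma a * Gamma (s - a) / Gamma s * of_real (x - t) powr (a - s))"
        using has_bochner_integral_integral_eq[OF has_bochner_integral_Beta_halfline[of a s "x - t"]] a x True
        by simp
      finally show ?thesis by simp
    qed (simp add: F_def legendre_weight_def)
  qed
  finally show ?thesis by (simp add: F_def euler_legendre_def)
qed

text \<open>The substitution \<open>t \<mapsto> (1 - x * t) / (x - t)\<close>, an involution of \<open>{-1<..<1}\<close>. It takes the place of Euler's
  transformation of the hypergeometric function.\<close>

lemma euler_legendre_reflection_real:
  assumes \<nu>: "Re \<nu> > -1" and q: "Re (\<nu> - \<mu> + 1) \<ge> 0" and x: "x > 1"
  shows "euler_legendre \<nu> (\<nu> - \<mu> + 1) (of_real x) = of_real (x\<^sup>2 - 1) powr \<mu> * euler_legendre \<nu> (\<nu> + \<mu> + 1) (of_real x)"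
proof -
  define g where "g t = (1 - x * t) / (x - t)" for t
  define h where "h t = (1 - x\<^sup>2) / (x - t)\<^sup>2" for t
  define f where "f t = legendre_weight \<nu> t * (of_real x - of_real t) powr (- (\<nu> - \<mu> + 1))" for t
  define S where "S = {-1<..<1::real}"
  have f: "integrable lborel f"
    unfolding f_def[abs_def] by (intro integrable_euler_legendre \<nu> q) (use x in \<open>simp add: legendre_domain_iff\<close>)
  have D: "x\<^sup>2 - 1 > 0" using x by (simp add: one_less_power)
  have pos: "x - t > 0" "1 - t\<^sup>2 > 0" if "t \<in> S" for t
    using that x abs_square_less_1[of t] by (auto simp: S_def abs_less_iff)
  have g1: "x - g t = (x\<^sup>2 - 1) / (x - t)" if "t \<in> S" for t
    using pos[OF that] by (simp add: g_def field_simps power2_eq_square)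
  have g2: "1 - (g t)\<^sup>2 = (x\<^sup>2 - 1) * (1 - t\<^sup>2) / ((x - t) * (x - t))" if "t \<in> S" for t
  proof -
    define B where "B = (x - t) * (x - t)"
    have "B \<noteq> 0" using pos[OF that] by (simp add: B_def)
    have "(g t)\<^sup>2 = (1 - x * t)\<^sup>2 / B" by (simp add: g_def B_def power2_eq_square)
    then have "1 - (g t)\<^sup>2 = (B - (1 - x * t)\<^sup>2) / B"
      using \<open>B \<noteq> 0\<close> by (simp add: diff_divide_distrib)
    also have "B - (1 - x * t)\<^sup>2 = (x\<^sup>2 - 1) * (1 - t\<^sup>2)"
      by (simp add: B_def power2_eq_square algebra_simps)
    finally show ?thesis by (simp add: B_def)
  qed
  have gS: "g t \<in> S" if "t \<in> S" for t
  proof -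
    have "(g t)\<^sup>2 < 1" using g2[OF that] pos[OF that] D by (smt (verit) divide_pos_pos mult_pos_pos)
    then show ?thesis using abs_square_less_1[of "g t"] by (auto simp: S_def abs_less_iff)
  qed
  \<comment> \<open>Being its own inverse on \<open>S\<close>, \<open>g\<close> is both onto and
    injective there.\<close>
  have gg: "g (g t) = t" if "t \<in> S" for t
  proof -
    have "1 - x * g t = t * (x\<^sup>2 - 1) / (x - t)"
      using pos[OF that] by (simp add: g_def field_simps power2_eq_square)
    then have "g (g t) = (t * (x\<^sup>2 - 1) / (x - t)) / ((x\<^sup>2 - 1) / (x - t))"
      unfolding g_def[of "g t"] g1[OF that] by simp
    then show ?thesis using pos[OF that] D by simp
  qed
  have img: "g ` S = S"
  proof (intro equalityI subsetI)
    fix t assume "t \<in> S"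
    then show "t \<in> g ` S" using gg[of t] gS[of t] by (metis image_eqI)
  qed (use gS in auto)
  have inj: "inj_on g S" by (rule inj_on_inverseI[of _ g]) (rule gg)
  have sub: "(LBINT t:S. \<bar>h t\<bar> *\<^sub>R f (g t)) = (LBINT t:S. f t)"
  proof (subst (2) img[symmetric], rule set_lborel_change_of_variables(2))
    show "(g has_field_derivative h t) (at t)" if "t \<in> S" for t
      unfolding g_def h_def using pos[OF that]
      by (auto intro!: derivative_eq_intros simp: power2_eq_square algebra_simps)
    show "set_integrable lborel (g ` S) f"
      unfolding set_integrable_def img using f by (intro integrable_mult_indicator) (auto simp: S_def)
    show "S \<in> sets borel" "g ` S \<in> sets borel" unfolding img by (simp_all add: S_def)
    show "f \<in> borel_measurable borel" "g \<in> borel_measurable borel" "h \<in> borel_measurable borel"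
      unfolding f_def g_def h_def by measurable
  qed (rule inj)
  have pw: "\<bar>h t\<bar> *\<^sub>R f (g t) = of_real (x\<^sup>2 - 1) powr \<mu> *
      (legendre_weight \<nu> t * (of_real x - of_real t) powr (- (\<nu> + \<mu> + 1)))" if t: "t \<in> S" for t
  proof -
    note pos = pos[OF t]
    \<comment> \<open>All bases are positive, so in terms of these logarithms the identity is linear
      in the exponent: \<nu>(d + p - 2y) - (\<nu> - \<mu> + 1)(d - y) + (d - 2y) = \<mu> d + \<nu> p
      - (\<nu> + \<mu> + 1) y.\<close>
    define d y p where "d = complex_of_real (ln (x\<^sup>2 - 1))" and "y = complex_of_real (ln (x - t))"
      and "p = complex_of_real (ln (1 - t\<^sup>2))"
    have "legendre_weight \<nu> (g t) = of_real ((x\<^sup>2 - 1) * (1 - t\<^sup>2) / ((x - t) * (x - t))) powr \<nu>"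
      using gS[OF t] unfolding g2[OF t, symmetric] by (simp add: legendre_weight_def S_def)
    also have "\<dots> = exp (\<nu> * (d + p - 2 * y))"
    proof -
      have "ln ((x\<^sup>2 - 1) * (1 - t\<^sup>2) / ((x - t) * (x - t))) = ln (x\<^sup>2 - 1) + ln (1 - t\<^sup>2) - 2 * ln (x - t)"
        using pos D by (simp add: ln_div ln_mult)
      moreover have "(x\<^sup>2 - 1) * (1 - t\<^sup>2) / ((x - t) * (x - t)) > 0" using pos D by simp
      ultimately show ?thesis
        by (subst of_real_powr_eq_exp) (simp_all only: d_def y_def p_def of_real_add of_real_diff of_real_mult of_real_numeral)
    qed
    finally have 1: "legendre_weight \<nu> (g t) = exp (\<nu> * (d + p - 2 * y))" .
    have 2: "(of_real x - of_real (g t)) powr (- (\<nu> - \<mu> + 1)) = exp (- (\<nu> - \<mu> + 1) * (d - y))"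
    proof -
      have "complex_of_real x - of_real (g t) = of_real ((x\<^sup>2 - 1) / (x - t))"
        by (simp only: g1[OF t] flip: of_real_diff)
      moreover have "ln ((x\<^sup>2 - 1) / (x - t)) = ln (x\<^sup>2 - 1) - ln (x - t)"
        using pos D by (simp add: ln_div)
      moreover have "(x\<^sup>2 - 1) / (x - t) > 0" using pos D by simp
      ultimately show ?thesis
        by (simp only: of_real_powr_eq_exp) (simp add: d_def y_def)
    qed
    have 3: "complex_of_real \<bar>h t\<bar> = exp (d - 2 * y)"
    proof -
      have "\<bar>h t\<bar> = (x\<^sup>2 - 1) / ((x - t) * (x - t))"
        using D by (simp add: h_def abs_divide flip: power2_eq_square)
      also have "\<dots> = exp (ln (x\<^sup>2 - 1) - 2 * ln (x - t))"
        using pos D by (simp add: exp_diff exp_double power2_eq_square)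
      finally show ?thesis by (simp add: d_def y_def exp_of_real[symmetric])
    qed
    have 4: "complex_of_real (x\<^sup>2 - 1) powr \<mu> = exp (\<mu> * d)"
      unfolding of_real_powr_eq_exp[OF D] d_def ..
    have 5: "legendre_weight \<nu> t = exp (\<nu> * p)"
      unfolding legendre_weight_def of_real_powr_eq_exp[OF pos(2)] p_def using t by (simp add: S_def)
    have 6: "(of_real x - of_real t) powr (- (\<nu> + \<mu> + 1)) = exp (- (\<nu> + \<mu> + 1) * y)"
      unfolding of_real_diff[symmetric] of_real_powr_eq_exp[OF pos(1)] y_def ..
    show ?thesis
      unfolding scaleR_conv_of_real f_def 1 2 3 4 5 6 by (simp add: algebra_simps flip: exp_add)
  qed
  have "euler_legendre \<nu> (\<nu> - \<mu> + 1) (of_real x) = (LBINT t:S. f t)"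
    unfolding euler_legendre_def set_lebesgue_integral_def
    by (rule Bochner_Integration.integral_cong) (auto simp: f_def S_def legendre_weight_def indicator_def)
  also have "\<dots> = (\<integral>t. of_real (x\<^sup>2 - 1) powr \<mu> *
      (legendre_weight \<nu> t * (of_real x - of_real t) powr (- (\<nu> + \<mu> + 1))) \<partial>lborel)"
    unfolding sub[symmetric] unfolding set_lebesgue_integral_def
    by (rule Bochner_Integration.integral_cong) (auto simp: pw indicator_def, auto simp: S_def legendre_weight_def)
  also have "\<dots> = of_real (x\<^sup>2 - 1) powr \<mu> * euler_legendre \<nu> (\<nu> + \<mu> + 1) (of_real x)"
    unfolding euler_legendre_def by (rule integral_mult_right_zero)
  finally show ?thesis .
qed

section \<open>Identification of Q and continuation to the cut plane\<close>

lemma holomorphic_on_sq_minus_one_powr: "(\<lambda>z. sq_minus_one_powr z a) holomorphic_on legendre_domain"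
  unfolding sq_minus_one_powr_def
  by (intro holomorphic_intros) (auto simp: legendre_domain_iff complex_nonpos_Reals_iff)

lemma sq_minus_one_powr_nonzero: "z \<in> legendre_domain \<Longrightarrow> sq_minus_one_powr z a \<noteq> 0"
  by (auto simp: sq_minus_one_powr_def legendre_domain_iff add_eq_0_iff2)

lemma sq_minus_one_powr_add: "sq_minus_one_powr z (a + b) = sq_minus_one_powr z a * sq_minus_one_powr z b"
  by (simp add: sq_minus_one_powr_def powr_add)

lemma sq_minus_one_powr_of_real:
  assumes "x > 1"
  shows "sq_minus_one_powr (of_real x) a = of_real (x\<^sup>2 - 1) powr a"
  using of_real_powr_mult[of "x - 1" "x + 1" a] assms
  by (simp add: sq_minus_one_powr_def algebra_simps power2_eq_square)

text \<open>The choice in \<open>legendre_Q\<close> is meaningful only once some continuation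
  exists. The Euler integral is such a witness, and the identity theorem shows that whatever
  function is chosen equals it. The constant is that of the series divided by the sqrt pi * Gamma
  (\<nu> + 1) of \<open>euler_legendre_series\<close>.\<close>

lemma legendre_Q_eq_euler_legendre:
  assumes \<nu>: "Re \<nu> > -1" and s: "Re (\<nu> + \<mu> + 1) \<ge> 0" and z: "z \<in> legendre_domain"
  shows "legendre_Q \<nu> \<mu> z = exp (\<i> * of_real pi * \<mu>) * Gamma (\<nu> + \<mu> + 1) / (2 powr (\<nu> + 1) * Gamma (\<nu> + 1)) *
           sq_minus_one_powr z (\<mu> / 2) * euler_legendre \<nu> (\<nu> + \<mu> + 1) z"
proof -
  define f where "f z = exp (\<i> * of_real pi * \<mu>) * Gamma (\<nu> + \<mu> + 1) / (2 powr (\<nu> + 1) * Gamma (\<nu> + 1)) *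
           sq_minus_one_powr z (\<mu> / 2) * euler_legendre \<nu> (\<nu> + \<mu> + 1) z" for z
  have hf: "f holomorphic_on legendre_domain"
    unfolding f_def
    by (intro holomorphic_on_mult holomorphic_on_const holomorphic_on_sq_minus_one_powr
        holomorphic_on_euler_legendre \<nu> s)
  have G: "Gamma (\<nu> + 1) \<noteq> 0" by (rule Gamma_nonzero_if_Re_pos) (use \<nu> in simp)
  have fs: "f z = legendre_Q_series \<nu> \<mu> z" if "z \<in> legendre_domain" "norm z > 1" for z
  proof -
    have "e * g / (p * G) * q * (r * G * inverse Z * H) = r * e * g * q / (p * Z) * H"
      if "G \<noteq> 0" "p \<noteq> 0" "Z \<noteq> 0" for e g p G q r Z H :: complex
      using that by (simp add: field_simps)
    moreover have "z \<noteq> 0" using that(2) by auto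
    moreover have two: "\<nu> + \<mu> + 1 + 1 = \<nu> + \<mu> + 2" by simp
    ultimately show ?thesis
      unfolding f_def legendre_Q_series_def euler_legendre_series[OF that \<nu>] powr_minus two
      using G by simp
  qed
  have ex: "f holomorphic_on legendre_domain \<and>
      (\<forall>z\<in>legendre_domain. norm z > 1 \<longrightarrow> f z = legendre_Q_series \<nu> \<mu> z)"
    using hf fs by blast
  have Q: "legendre_Q \<nu> \<mu> holomorphic_on legendre_domain"
    "\<And>z. z \<in> legendre_domain \<Longrightarrow> norm z > 1 \<Longrightarrow> legendre_Q \<nu> \<mu> z = legendre_Q_series \<nu> \<mu> z"
    using someI[of "\<lambda>f. f holomorphic_on legendre_domain \<and>
      (\<forall>z\<in>legendre_domain. norm z > 1 \<longrightarrow> f z = legendre_Q_series \<nu> \<mu> z)", OF ex]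
    unfolding legendre_Q_def[symmetric] by auto
  have "legendre_Q \<nu> \<mu> z = f z"
  \<comment> \<open>This half-plane is an open part of the cut plane on which |z| > 1, so both
    functions equal the series there.\<close>
  proof (rule analytic_continuation_open[of "{z. Re z > 1}" legendre_domain "legendre_Q \<nu> \<mu>" f])
    show "open {z. Re z > 1}" by (rule open_halfspace_Re_gt)
    show "{z. Re z > 1} \<noteq> {}" by (auto intro!: exI[of _ 2])
    show "{z. Re z > 1} \<subseteq> legendre_domain" by (auto simp: legendre_domain_iff)
    fix z assume "z \<in> {z. Re z > 1}"
    then have "z \<in> legendre_domain" "norm z > 1"
      using complex_Re_le_cmod[of z] by (auto simp: legendre_domain_iff)
    then show "legendre_Q \<nu> \<mu> z = f z" using Q(2) fs by simp
  qed (use open_legendre_domain connected_legendre_domain Q hf z in auto)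
  then show ?thesis by (simp add: f_def)
qed

lemma integral_euler_legendre:
  assumes \<mu>: "Re \<mu> > 0" and \<nu>: "Re (\<nu> - \<mu>) > -1" and z: "z \<in> legendre_domain"
  shows "(\<integral>u. gamma_weight (2 * \<mu>) u * euler_legendre \<nu> (\<nu> + \<mu> + 1) (z + of_real u) \<partial>lborel) =
    Gamma (2 * \<mu>) * Gamma (\<nu> - \<mu> + 1) / Gamma (\<nu> + \<mu> + 1) * sq_minus_one_powr z \<mu> * euler_legendre \<nu> (\<nu> + \<mu> + 1) z"
proof -
  define R where "R z = (\<integral>u. gamma_weight (2 * \<mu>) u * euler_legendre \<nu> (\<nu> + \<mu> + 1) (z + of_real u) \<partial>lborel)" for z
  define L where "L z = Gamma (2 * \<mu>) * Gamma (\<nu> - \<mu> + 1) / Gamma (\<nu> + \<mu> + 1) * sq_minus_one_powr z \<mu> *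
    euler_legendre \<nu> (\<nu> + \<mu> + 1) z" for z
  have "(\<lambda>z. R z - L z) holomorphic_on legendre_domain"
    unfolding R_def L_def using \<mu> \<nu>
    by (intro holomorphic_on_diff holomorphic_on_integral_euler_legendre holomorphic_on_mult holomorphic_on_const
      holomorphic_on_sq_minus_one_powr holomorphic_on_euler_legendre) auto
  moreover have "of_real ` {1<..} \<subseteq> legendre_domain" by (auto simp: legendre_domain_iff)
  moreover have "2 \<in> legendre_domain" by (simp add: legendre_domain_iff)
  \<comment> \<open>The two sides are compared only on a real ray, which is not open in the complex
    plane, so the identity theorem is used in its limit point form. Any point of the ray would serve
    in place of 2.\<close>
  moreover have "(2::complex) islimpt of_real ` {1<..}"
  proof -
    have "(2::real) islimpt {1<..}" by (rule interior_limit_point) (simp add: interior_open)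
    then show ?thesis
      unfolding islimpt_sequential
    proof (elim exE conjE)
      fix X :: "nat \<Rightarrow> real" assume "\<forall>n. X n \<in> {1<..} - {2}" "X \<longlonglongrightarrow> 2"
      then show "\<exists>f. (\<forall>n. f n \<in> complex_of_real ` {1<..} - {2}) \<and> f \<longlonglongrightarrow> 2"
        using tendsto_of_real[of X 2 sequentially, where 'a = complex]
        by (intro exI[of _ "\<lambda>n. of_real (X n)"]) (auto simp: complex_eq_iff)
    qed
  qed
  moreover have "R z - L z = 0" if "z \<in> of_real ` {1<..}" for z
  proof -
    from that obtain x where x: "z = of_real x" "x > 1" by auto
    have "R z = Gamma (2 * \<mu>) * Gamma (\<nu> + \<mu> + 1 - 2 * \<mu>) / Gamma (\<nu> + \<mu> + 1) *
        euler_legendre \<nu> (\<nu> + \<mu> + 1 - 2 * \<mu>) (of_real x)"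
      unfolding R_def x(1) by (rule integral_euler_legendre_real) (use \<mu> \<nu> x in auto)
    moreover have "\<nu> + \<mu> + 1 - 2 * \<mu> = \<nu> - \<mu> + 1" by simp
    moreover have "euler_legendre \<nu> (\<nu> - \<mu> + 1) (of_real x) = of_real (x\<^sup>2 - 1) powr \<mu> * euler_legendre \<nu> (\<nu> + \<mu> + 1) (of_real x)"
      by (rule euler_legendre_reflection_real) (use \<mu> \<nu> x in auto)
    ultimately show ?thesis
      by (simp only: L_def x(1) sq_minus_one_powr_of_real[OF x(2)]) simp
  qed
  ultimately have "R z - L z = 0"
    using analytic_continuation[OF _ open_legendre_domain connected_legendre_domain] z by blast
  then show ?thesis by (simp add: R_def L_def)
qed

theorem theorem52:
  fixes z \<nu> \<mu> :: complex
  assumes "z \<in> legendre_domain"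
    and "\<nu> \<noteq> 0" and "\<mu> \<noteq> 0"
    and "Re \<mu> > 0" and "Re (\<nu> - \<mu>) > -1"
  shows "ray_integrable z (\<lambda>w. legendre_Q \<nu> \<mu> w * (w - z) powr (2 * \<mu> - 1) / sq_minus_one_powr w (\<mu> / 2))
    \<and> legendre_Q \<nu> \<mu> z =
        Gamma (\<nu> + \<mu> + 1) / (Gamma (2 * \<mu>) * Gamma (\<nu> - \<mu> + 1) * sq_minus_one_powr z (\<mu> / 2))
        * ray_integral z (\<lambda>w. legendre_Q \<nu> \<mu> w * (w - z) powr (2 * \<mu> - 1) / sq_minus_one_powr w (\<mu> / 2))"
proof -
  define K where "K = exp (\<i> * of_real pi * \<mu>) * Gamma (\<nu> + \<mu> + 1) / (2 powr (\<nu> + 1) * Gamma (\<nu> + 1))"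
  define E where "E = euler_legendre \<nu> (\<nu> + \<mu> + 1)"
  note z = assms(1) and \<mu> = assms(4)
  have \<nu>: "Re \<nu> > -1" and s: "Re (\<nu> + \<mu> + 1) \<ge> 0" using assms(4,5) by auto
  have Q: "legendre_Q \<nu> \<mu> w = K * sq_minus_one_powr w (\<mu> / 2) * E w" if "w \<in> legendre_domain" for w
    unfolding K_def E_def using legendre_Q_eq_euler_legendre[OF \<nu> s that] .
  let ?f = "\<lambda>w. legendre_Q \<nu> \<mu> w * (w - z) powr (2 * \<mu> - 1) / sq_minus_one_powr w (\<mu> / 2)"
  \<comment> \<open>The power of w^2 - 1 in Q cancels against the denominator of the integrand, so Q
    enters the integral only through the constant \<open>K\<close> and the Euler integral.\<close>
  have f: "(\<lambda>u. indicat_real {0<..} u *\<^sub>R ?f (z + of_real u)) = (\<lambda>u. K * (gamma_weight (2 * \<mu>) u * E (z + of_real u)))"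
  proof
    fix u :: real
    show "indicat_real {0<..} u *\<^sub>R ?f (z + of_real u) = K * (gamma_weight (2 * \<mu>) u * E (z + of_real u))"
    proof (cases "u > 0")
      case True
      then have "z + of_real u \<in> legendre_domain" using z by (intro legendre_domain_add) auto
      then show ?thesis using True by (simp add: Q sq_minus_one_powr_nonzero gamma_weight_def)
    qed (simp add: gamma_weight_def)
  qed
  have "ray_integrable z ?f"
    unfolding ray_integrable_def set_integrable_def f E_def
    using assms \<nu> by (intro integrable_mult_right integrable_gamma_weight_euler_legendre) auto
  moreover have "ray_integral z ?f = K * (Gamma (2 * \<mu>) * Gamma (\<nu> - \<mu> + 1) / Gamma (\<nu> + \<mu> + 1) * sq_minus_one_powr z \<mu> * E z)"
    unfolding ray_integral_def set_lebesgue_integral_def f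
    using integral_euler_legendre[OF assms(4,5) z] by (simp add: E_def)
  moreover have "Gamma (2 * \<mu>) \<noteq> 0" "Gamma (\<nu> - \<mu> + 1) \<noteq> 0" "Gamma (\<nu> + \<mu> + 1) \<noteq> 0"
    using assms(4,5) by (auto intro!: Gamma_nonzero_if_Re_pos)
  \<comment> \<open>One half cancels against the denominator in front of the integral; the other is
    the power contained in Q at z.\<close>
  moreover have "sq_minus_one_powr z \<mu> = sq_minus_one_powr z (\<mu> / 2) * sq_minus_one_powr z (\<mu> / 2)"
    using sq_minus_one_powr_add[of z "\<mu> / 2" "\<mu> / 2"] by simp
  ultimately show ?thesis
    using sq_minus_one_powr_nonzero[OF z, of "\<mu> / 2"] by (simp add: Q[OF z])
qed

end
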